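(* Let $M$ be a screen generic lightlike submanifold of a locally bronze semi-Riemannian manifold $(\bar M,\bar g,\bar J)$ with an $(l,m)$-type connection $\bar\Omega$. Then the distribution $B_o$ is parallel if and only if both of the following hold for all $X,Y\in\Gamma(B_o)$, $Z\in\Gamma(B')$ and $N\in\Gamma(\mathrm{ltr}(TM))$: (i) $\bar g(\bar h^{*}(X,\bar JY),\bar JN)=3\bar g(\bar h^{*}(X,\bar JY),N)$; (ii) $\bar g(\Omega^{*}_X\bar JY,fZ)+\bar g(\bar h^{s}(X,\bar JY),\bar JZ)=3\bar g(\Omega^{*}_X\bar JY,Z)$.
   Context: Bronze manifold: a semi-Riemannian manifold $(\bar M,\bar g)$ (of constant index $q$, $1\le q\le \dim\bar M-1$) with a $(1,1)$-tensor field $\bar J$ satisfying $\bar J^2=3\bar J+I$ and $\bar g(\bar JX,Y)=\bar g(X,\bar JY)$; it is locally bronze if $\bar\nabla\bar J=0$ for the Levi-Civita connection $\bar\nabla$. Lightlike submanifold: $M\subset\bar M$ such that $\mathrm{Rad}\,TM=TM\cap TM^\perp$ is a distribution of constant rank $r>0$; $g$ is the induced metric. One fixes $S(TM)$, $S(TM^\perp)$ with $TM=\mathrm{Rad}\,TM\perp S(TM)$, $TM^\perp=\mathrm{Rad}\,TM\perp S(TM^\perp)$, and a lightlike transversal bundle $\mathrm{ltr}(TM)$ (locally spanned by $N_1,\dots,N_r$ in $S(TM^\perp)^\perp$, orthogonal to $S(TM)$, with $\bar g(N_i,\xi_j)=\delta_{ij}$, $\bar g(N_i,N_j)=0$ for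 a local basis $\xi_1,\dots,\xi_r$ of $\mathrm{Rad}\,TM$). Then $T\bar M|_M=TM\oplus \mathrm{tr}(TM)$ with $\mathrm{tr}(TM)=\mathrm{ltr}(TM)\perp S(TM^\perp)$. For $X\in\Gamma(TM)$ write $\bar JX=fX+wX$ with $fX$ tangential and $wX\in\Gamma(\mathrm{tr}(TM))$. Screen generic: $M$ is screen generic if $\bar J(\mathrm{Rad}\,TM)=\mathrm{Rad}\,TM$ and $B_o=\bar J(S(TM))\cap S(TM)$ is a non-degenerate distribution; $B'$ denotes the complementary (orthogonal) non-degenerate distribution in $S(TM)$, so $S(TM)=B_o\oplus B'$, with (when $B'\neq\{0\}$) $\bar J(B')\not\subseteq S(TM)$ and $\bar J(B')\not\subseteq S(TM^\perp)$, and $fY\in\Gamma(B')$, $wY\in\Gamma(S(TM^\perp))$ for $Y\in\Gamma(B')$. $(l,m)$-type connection: let $l,m$ be smooth functions on $\bar M$, $(l,m)\ne(0,0)$, $\eta$ a smooth unit spacelike vector field on $\bar M$, $\theta(X)=\bar g(X,\eta)$. Then $\bar\Omega_XY=\bar\nabla_XY+\theta(Y)\{lX+m\bar JX\}$. Induced objects: for $X,Y\in\Gamma(TM)$, $\bar\Omega_XY=\Omega_XY+\bar h^{l}(X,Y)+\bar h^{s}(X,Y)$ with components in $TM$, $\mathrm{ltr}(TM)$, $S(TM^\perp)$ respectively; for $Y\in\Gamma(S(TM))$, $\Omega_XY=\Omega^{*}_XY+\bar h^{*}(X,Y)$ with $\Omega^*_XY\in\Gamma(S(TM))$, $\bar h^*(X,Y)\in\Gamma(\mathrm{Rad}\,TM)$.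 $B_o$ is parallel if $\Omega_XY\in\Gamma(B_o)$ for all $X,Y\in\Gamma(B_o)$, i.e. $\bar g(\Omega_XY,Z)=0$ and $\bar g(\Omega_XY,N)=0$ for all $Z\in\Gamma(B')$, $N\in\Gamma(\mathrm{ltr}(TM))$. *)

theory Defs
  imports "HOL-Analysis.Analysis"
begin

section \<open>Smooth manifolds, tangent vectors and vector fields\<close>

fun Ck_on :: "nat \<Rightarrow> 'm::euclidean_space set \<Rightarrow> ('m \<Rightarrow> 'n::euclidean_space) \<Rightarrow> bool" where
  "Ck_on 0 S f \<longleftrightarrow> continuous_on S f"
| "Ck_on (Suc k) S f \<longleftrightarrow>
     (\<forall>x\<in>S. f differentiable (at x)) \<and> (\<forall>v. Ck_on k S (\<lambda>x. frechet_derivative f (at x) v))"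

text \<open>Only used for open \<open>S\<close>.\<close>
definition smooth_on :: "'m::euclidean_space set \<Rightarrow> ('m \<Rightarrow> 'n::euclidean_space) \<Rightarrow> bool" where
  "smooth_on S f \<longleftrightarrow> (\<forall>k. Ck_on k S f)"

type_synonym ('a, 'e) chart = "'a set \<times> ('a \<Rightarrow> 'e)"

definition coord_inv :: "('a, 'e) chart \<Rightarrow> 'e \<Rightarrow> 'a" where
  "coord_inv c = inv_into (fst c) (snd c)"

definition is_chart :: "('a::topological_space, 'e::euclidean_space) chart \<Rightarrow> bool" where
  "is_chart c \<longleftrightarrow> open (fst c) \<and> open (snd c ` fst c) \<and>
     homeomorphism (fst c) (snd c ` fst c) (snd c) (coord_inv c)"

text \<open>A smooth manifold is the whole of a Hausdorff, second countable space \<open>'a\<close> with a smooth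
  atlas modelled on \<open>'e\<close>; its dimension is \<open>DIM('e)\<close>.\<close>
definition smooth_atlas ::
    "('a::{t2_space, second_countable_topology}, 'e::euclidean_space) chart set \<Rightarrow> bool" where
  "smooth_atlas A \<longleftrightarrow> (\<forall>c\<in>A. is_chart c) \<and> (\<Union>c\<in>A. fst c) = UNIV \<and>
     (\<forall>c\<in>A. \<forall>c'\<in>A. smooth_on (snd c ` (fst c \<inter> fst c')) (snd c' \<circ> coord_inv c))"

definition smooth_fun ::
    "('a::topological_space, 'e::euclidean_space) chart set \<Rightarrow> ('a \<Rightarrow> real) \<Rightarrow> bool" where
  "smooth_fun A f \<longleftrightarrow> (\<forall>c\<in>A. smooth_on (snd c ` fst c) (f \<circ> coord_inv c))"

definition smooth_map ::
    "('b::topological_space, 'd::euclidean_space) chart set \<Rightarrow>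
     ('a::topological_space, 'e::euclidean_space) chart set \<Rightarrow> ('b \<Rightarrow> 'a) \<Rightarrow> bool" where
  "smooth_map B A \<iota> \<longleftrightarrow> continuous_on UNIV \<iota> \<and>
     (\<forall>b\<in>B. \<forall>c\<in>A. smooth_on (snd b ` (fst b \<inter> \<iota> -` fst c)) (snd c \<circ> \<iota> \<circ> coord_inv b))"

text \<open>We choose, once and for all, a chart of the atlas around each point. A tangent vector at
  \<open>p\<close> is represented by its coordinate vector in \<open>chart_at A p\<close>, so that the tangent space at each
  point is a copy of \<open>'e\<close>. A vector field is a function of type \<open>'a \<Rightarrow> 'e\<close>; since the chosen chart
  may jump from point to point, smoothness of a vector field is NOT smoothness of this function,
  but is expressed through the action on smooth functions (\<open>deriv_along\<close>), which does not depend
  on the choice of charts.\<close>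
definition chart_at :: "('a, 'e) chart set \<Rightarrow> 'a \<Rightarrow> ('a, 'e) chart" where
  "chart_at A p = (SOME c. c \<in> A \<and> p \<in> fst c)"

definition deriv_along ::
    "('a, 'e::euclidean_space) chart set \<Rightarrow> 'a \<Rightarrow> 'e \<Rightarrow> ('a \<Rightarrow> real) \<Rightarrow> real" where
  "deriv_along A p v f =
     frechet_derivative (f \<circ> coord_inv (chart_at A p)) (at (snd (chart_at A p) p)) v"

definition tangent_map ::
    "('b, 'd::euclidean_space) chart set \<Rightarrow> ('a, 'e::euclidean_space) chart set \<Rightarrow> ('b \<Rightarrow> 'a) \<Rightarrow>
     'b \<Rightarrow> 'd \<Rightarrow> 'e" where
  "tangent_map B A \<iota> x w =
     frechet_derivative (snd (chart_at A (\<iota> x)) \<circ> \<iota> \<circ> coord_inv (chart_at B x))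
       (at (snd (chart_at B x) x)) w"

definition smooth_vf ::
    "('a::topological_space, 'e::euclidean_space) chart set \<Rightarrow> ('a \<Rightarrow> 'e) \<Rightarrow> bool" where
  "smooth_vf A X \<longleftrightarrow> (\<forall>f. smooth_fun A f \<longrightarrow> smooth_fun A (\<lambda>p. deriv_along A p (X p) f))"


section \<open>Semi-Riemannian metrics, bronze structures, connections\<close>

definition nondegenerate_on :: "('e \<Rightarrow> 'e \<Rightarrow> real) \<Rightarrow> 'e::euclidean_space set \<Rightarrow> bool" where
  "nondegenerate_on b W \<longleftrightarrow> (\<forall>u\<in>W. (\<forall>v\<in>W. b u v = 0) \<longrightarrow> u = 0)"

definition form_index :: "('e::euclidean_space \<Rightarrow> 'e \<Rightarrow> real) \<Rightarrow> nat" where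
  "form_index b = Max {dim W |W. subspace W \<and> (\<forall>w\<in>W. w \<noteq> 0 \<longrightarrow> b w w < 0)}"

definition semi_riemannian_metric ::
    "('a::topological_space, 'e::euclidean_space) chart set \<Rightarrow> ('a \<Rightarrow> 'e \<Rightarrow> 'e \<Rightarrow> real) \<Rightarrow> nat \<Rightarrow> bool"
  where
  "semi_riemannian_metric A g q \<longleftrightarrow>
     (\<forall>p. bilinear (g p) \<and> (\<forall>u v. g p u v = g p v u) \<and> nondegenerate_on (g p) UNIV \<and>
          form_index (g p) = q) \<and>
     (\<forall>X Y. smooth_vf A X \<longrightarrow> smooth_vf A Y \<longrightarrow> smooth_fun A (\<lambda>p. g p (X p) (Y p)))"

definition bronze_structure ::
    "('a::topological_space, 'e::euclidean_space) chart set \<Rightarrow> ('a \<Rightarrow> 'e \<Rightarrow> 'e \<Rightarrow> real) \<Rightarrow>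
     ('a \<Rightarrow> 'e \<Rightarrow> 'e) \<Rightarrow> bool" where
  "bronze_structure A g J \<longleftrightarrow>
     (\<forall>p. linear (J p) \<and> (\<forall>v. J p (J p v) = 3 *\<^sub>R J p v + v) \<and>
          (\<forall>u v. g p (J p u) v = g p u (J p v))) \<and>
     (\<forall>X. smooth_vf A X \<longrightarrow> smooth_vf A (\<lambda>p. J p (X p)))"

text \<open>A connection is given in the pointwise form \<open>\<nabla> p v Y\<close>, the covariant derivative at \<open>p\<close> of the
  vector field \<open>Y\<close> in the direction of the tangent vector \<open>v\<close> at \<open>p\<close>; thus
  \<open>(\<nabla>\<^sub>X Y)(p) = \<nabla> p (X p) Y\<close>. Its values are only meaningful for smooth \<open>Y\<close>.\<close>
type_synonym ('a, 'e) connection = "'a \<Rightarrow> 'e \<Rightarrow> ('a \<Rightarrow> 'e) \<Rightarrow> 'e"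

definition linear_connection ::
    "('a::topological_space, 'e::euclidean_space) chart set \<Rightarrow> ('a, 'e) connection \<Rightarrow> bool" where
  "linear_connection A nabla \<longleftrightarrow>
     (\<forall>p Y. smooth_vf A Y \<longrightarrow> linear (\<lambda>v. nabla p v Y)) \<and>
     (\<forall>p v Y Z. smooth_vf A Y \<longrightarrow> smooth_vf A Z \<longrightarrow>
        nabla p v (\<lambda>q. Y q + Z q) = nabla p v Y + nabla p v Z) \<and>
     (\<forall>p v f Y. smooth_fun A f \<longrightarrow> smooth_vf A Y \<longrightarrow>
        nabla p v (\<lambda>q. f q *\<^sub>R Y q) = deriv_along A p v f *\<^sub>R Y p + f p *\<^sub>R nabla p v Y) \<and>
     (\<forall>X Y. smooth_vf A X \<longrightarrow> smooth_vf A Y \<longrightarrow> smooth_vf A (\<lambda>p. nabla p (X p) Y))"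

text \<open>Torsion-freeness \<open>\<nabla>\<^sub>X Y - \<nabla>\<^sub>Y X = [X, Y]\<close> is stated through the action of both sides on
  smooth functions, \<open>[X, Y] f = X (Y f) - Y (X f)\<close>.\<close>
definition levi_civita ::
    "('a::topological_space, 'e::euclidean_space) chart set \<Rightarrow> ('a \<Rightarrow> 'e \<Rightarrow> 'e \<Rightarrow> real) \<Rightarrow>
     ('a, 'e) connection \<Rightarrow> bool" where
  "levi_civita A g nabla \<longleftrightarrow> linear_connection A nabla \<and>
     (\<forall>p X Y f. smooth_vf A X \<longrightarrow> smooth_vf A Y \<longrightarrow> smooth_fun A f \<longrightarrow>
        deriv_along A p (nabla p (X p) Y - nabla p (Y p) X) f =
        deriv_along A p (X p) (\<lambda>q. deriv_along A q (Y q) f) -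
        deriv_along A p (Y p) (\<lambda>q. deriv_along A q (X q) f)) \<and>
     (\<forall>p v Y Z. smooth_vf A Y \<longrightarrow> smooth_vf A Z \<longrightarrow>
        deriv_along A p v (\<lambda>q. g q (Y q) (Z q)) = g p (nabla p v Y) (Z p) + g p (Y p) (nabla p v Z))"

definition parallel_tensor ::
    "('a::topological_space, 'e::euclidean_space) chart set \<Rightarrow> ('a, 'e) connection \<Rightarrow>
     ('a \<Rightarrow> 'e \<Rightarrow> 'e) \<Rightarrow> bool" where
  "parallel_tensor A nabla J \<longleftrightarrow>
     (\<forall>p v Y. smooth_vf A Y \<longrightarrow> nabla p v (\<lambda>q. J q (Y q)) = J p (nabla p v Y))"

definition lm_connection ::
    "('a \<Rightarrow> 'e \<Rightarrow> 'e \<Rightarrow> real) \<Rightarrow> ('a \<Rightarrow> 'e \<Rightarrow> 'e) \<Rightarrow> ('a, 'e::euclidean_space) connection \<Rightarrow>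
     ('a \<Rightarrow> real) \<Rightarrow> ('a \<Rightarrow> real) \<Rightarrow> ('a \<Rightarrow> 'e) \<Rightarrow> ('a, 'e) connection" where
  "lm_connection g J nabla l m \<eta> p v Y =
     nabla p v Y + g p (Y p) (\<eta> p) *\<^sub>R (l p *\<^sub>R v + m p *\<^sub>R J p v)"


section \<open>Submanifolds and bundles along them\<close>

text \<open>The submanifold \<open>M\<close> is a manifold \<open>'b\<close> of its own together with the inclusion \<open>\<iota>\<close> into the
  ambient manifold, an injective immersion (the topology of \<open>'b\<close> may be finer than the induced
  one). Bundles along \<open>M\<close> are functions \<open>E\<close> with \<open>E x\<close> a subspace of the ambient tangent space at
  \<open>\<iota> x\<close>.\<close>
definition submanifold_incl ::
    "('b::topological_space, 'd::euclidean_space) chart set \<Rightarrow>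
     ('a::topological_space, 'e::euclidean_space) chart set \<Rightarrow> ('b \<Rightarrow> 'a) \<Rightarrow> bool" where
  "submanifold_incl B A \<iota> \<longleftrightarrow> smooth_map B A \<iota> \<and> inj \<iota> \<and> (\<forall>x. inj (tangent_map B A \<iota> x))"

definition local_extension ::
    "('a::topological_space, 'e::euclidean_space) chart set \<Rightarrow> ('b::topological_space \<Rightarrow> 'a) \<Rightarrow>
     'b \<Rightarrow> ('b \<Rightarrow> 'e) \<Rightarrow> ('a \<Rightarrow> 'e) \<Rightarrow> bool" where
  "local_extension A \<iota> x Y Y' \<longleftrightarrow>
     smooth_vf A Y' \<and> (\<exists>U. open U \<and> x \<in> U \<and> (\<forall>y\<in>U. Y' (\<iota> y) = Y y))"

text \<open>Smooth sections of the ambient tangent bundle restricted to \<open>M\<close>: as \<open>\<iota>\<close> is an immersion, these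
  are the fields along \<open>M\<close> that are locally restrictions of smooth ambient vector fields.\<close>
definition smooth_along ::
    "('a::topological_space, 'e::euclidean_space) chart set \<Rightarrow> ('b::topological_space \<Rightarrow> 'a) \<Rightarrow>
     ('b \<Rightarrow> 'e) \<Rightarrow> bool" where
  "smooth_along A \<iota> Y \<longleftrightarrow> (\<forall>x. \<exists>Y'. local_extension A \<iota> x Y Y')"

text \<open>An ambient connection applied to fields along \<open>M\<close>, by extending \<open>Y\<close> locally; for \<open>v\<close> tangent
  to \<open>M\<close> the value does not depend on the extension.\<close>
definition connection_along ::
    "('a::topological_space, 'e::euclidean_space) chart set \<Rightarrow> ('b::topological_space \<Rightarrow> 'a) \<Rightarrow>
     ('a, 'e) connection \<Rightarrow> 'b \<Rightarrow> 'e \<Rightarrow> ('b \<Rightarrow> 'e) \<Rightarrow> 'e" where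
  "connection_along A \<iota> D x v Y = D (\<iota> x) v (SOME Y'. local_extension A \<iota> x Y Y')"

text \<open>Local frames are taken to be (restrictions of) globally defined smooth fields \<open>s i\<close> along \<open>M\<close>,
  which need to lie in \<open>E\<close> only over \<open>U\<close>: multiplying a local frame by a cut-off function and
  shrinking \<open>U\<close> gives such fields.\<close>
definition smooth_subbundle ::
    "('a::topological_space, 'e::euclidean_space) chart set \<Rightarrow> ('b::topological_space \<Rightarrow> 'a) \<Rightarrow>
     nat \<Rightarrow> ('b \<Rightarrow> 'e set) \<Rightarrow> bool" where
  "smooth_subbundle A \<iota> k E \<longleftrightarrow> (\<forall>x. subspace (E x) \<and> dim (E x) = k) \<and>
     (\<forall>x. \<exists>U s. open U \<and> x \<in> U \<and> (\<forall>i<k. smooth_along A \<iota> (s i)) \<and>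
        (\<forall>y\<in>U. E y = span ((\<lambda>i. s i y) ` {..<k})))"

definition sections ::
    "('a::topological_space, 'e::euclidean_space) chart set \<Rightarrow> ('b::topological_space \<Rightarrow> 'a) \<Rightarrow>
     ('b \<Rightarrow> 'e set) \<Rightarrow> ('b \<Rightarrow> 'e) set" where
  "sections A \<iota> E = {X. smooth_along A \<iota> X \<and> (\<forall>x. X x \<in> E x)}"

definition orth_compl :: "('e \<Rightarrow> 'e \<Rightarrow> real) \<Rightarrow> 'e set \<Rightarrow> 'e set" where
  "orth_compl b W = {v. \<forall>u\<in>W. b u v = 0}"

definition orth_direct_sum ::
    "('e \<Rightarrow> 'e \<Rightarrow> real) \<Rightarrow> 'e::euclidean_space set \<Rightarrow> 'e set \<Rightarrow> 'e set \<Rightarrow> bool" where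
  "orth_direct_sum b W W1 W2 \<longleftrightarrow>
     W = {u + v |u v. u \<in> W1 \<and> v \<in> W2} \<and> W1 \<inter> W2 = {0} \<and> (\<forall>u\<in>W1. \<forall>v\<in>W2. b u v = 0)"

text \<open>The component of \<open>v\<close> in \<open>E\<close> with respect to a direct sum decomposition \<open>E \<oplus> F\<close>.\<close>
definition component :: "'e::euclidean_space set \<Rightarrow> 'e set \<Rightarrow> 'e \<Rightarrow> 'e" where
  "component E F v = (THE u. u \<in> E \<and> v - u \<in> F)"


section \<open>Screen generic lightlike submanifolds\<close>

text \<open>All data: atlases of ambient manifold and submanifold, inclusion, metric, bronze structure,
  Levi-Civita connection, the functions \<open>l\<close>, \<open>m\<close> and the vector field \<open>\<eta>\<close>, and the chosen bundles
  \<open>S(TM)\<close>, \<open>S(TM\<^sup>\<bottom>)\<close>, \<open>ltr(TM)\<close>.\<close>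
record ('a, 'b, 'e, 'd) lightlike_data =
  amb :: "('a, 'e) chart set"
  sub :: "('b, 'd) chart set"
  incl :: "'b \<Rightarrow> 'a"
  metric :: "'a \<Rightarrow> 'e \<Rightarrow> 'e \<Rightarrow> real"
  bronze :: "'a \<Rightarrow> 'e \<Rightarrow> 'e"
  levi :: "('a, 'e) connection"
  coef_l :: "'a \<Rightarrow> real"
  coef_m :: "'a \<Rightarrow> real"
  eta :: "'a \<Rightarrow> 'e"
  scr :: "'b \<Rightarrow> 'e set"
  scr_perp :: "'b \<Rightarrow> 'e set"
  ltr :: "'b \<Rightarrow> 'e set"

text \<open>Metric and bronze structure over points of \<open>M\<close>.\<close>
definition gM :: "('a, 'b, 'e, 'd) lightlike_data \<Rightarrow> 'b \<Rightarrow> 'e \<Rightarrow> 'e \<Rightarrow> real" where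
  "gM L x = metric L (incl L x)"

definition JM :: "('a, 'b, 'e, 'd) lightlike_data \<Rightarrow> 'b \<Rightarrow> 'e \<Rightarrow> 'e" where
  "JM L x = bronze L (incl L x)"

definition TM :: "('a, 'b, 'e::euclidean_space, 'd::euclidean_space) lightlike_data \<Rightarrow> 'b \<Rightarrow> 'e set"
  where "TM L x = range (tangent_map (sub L) (amb L) (incl L) x)"

definition TM_perp ::
    "('a, 'b, 'e::euclidean_space, 'd::euclidean_space) lightlike_data \<Rightarrow> 'b \<Rightarrow> 'e set" where
  "TM_perp L x = orth_compl (gM L x) (TM L x)"

definition RadTM ::
    "('a, 'b, 'e::euclidean_space, 'd::euclidean_space) lightlike_data \<Rightarrow> 'b \<Rightarrow> 'e set" where
  "RadTM L x = TM L x \<inter> TM_perp L x"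

definition tr :: "('a, 'b, 'e::euclidean_space, 'd) lightlike_data \<Rightarrow> 'b \<Rightarrow> 'e set" where
  "tr L x = {u + v |u v. u \<in> ltr L x \<and> v \<in> scr_perp L x}"

abbreviation \<Gamma> ::
    "('a::topological_space, 'b::topological_space, 'e::euclidean_space, 'd) lightlike_data \<Rightarrow>
     ('b \<Rightarrow> 'e set) \<Rightarrow> ('b \<Rightarrow> 'e) set" where
  "\<Gamma> L E \<equiv> sections (amb L) (incl L) E"

definition lightlike_transversal ::
    "('a::topological_space, 'b::topological_space, 'e::euclidean_space, 'd::euclidean_space)
       lightlike_data \<Rightarrow> nat \<Rightarrow> bool" where
  "lightlike_transversal L r \<longleftrightarrow>
     (\<forall>x. \<exists>U \<xi> N. open U \<and> x \<in> U \<and>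
        (\<forall>i<r. smooth_along (amb L) (incl L) (\<xi> i) \<and> smooth_along (amb L) (incl L) (N i)) \<and>
        (\<forall>y\<in>U. RadTM L y = span ((\<lambda>i. \<xi> i y) ` {..<r}) \<and>
               ltr L y = span ((\<lambda>i. N i y) ` {..<r}) \<and>
               (\<forall>i<r. N i y \<in> orth_compl (gM L y) (scr_perp L y) \<inter> orth_compl (gM L y) (scr L y)) \<and>
               (\<forall>i<r. \<forall>j<r. gM L y (N i y) (\<xi> j y) = (if i = j then 1 else 0) \<and>
                             gM L y (N i y) (N j y) = 0)))"

definition lightlike_submanifold ::
    "('a::topological_space, 'b::topological_space, 'e::euclidean_space, 'd::euclidean_space)
       lightlike_data \<Rightarrow> bool" where
  "lightlike_submanifold L \<longleftrightarrow>
     submanifold_incl (sub L) (amb L) (incl L) \<and>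
     (\<exists>r>0. smooth_subbundle (amb L) (incl L) r (RadTM L) \<and> lightlike_transversal L r) \<and>
     (\<exists>k. smooth_subbundle (amb L) (incl L) k (scr L)) \<and>
     (\<exists>k. smooth_subbundle (amb L) (incl L) k (scr_perp L)) \<and>
     (\<forall>x. orth_direct_sum (gM L x) (TM L x) (RadTM L x) (scr L x) \<and>
          orth_direct_sum (gM L x) (TM_perp L x) (RadTM L x) (scr_perp L x))"

text \<open>The tangential and transversal parts of \<open>J\<close> on vectors over \<open>M\<close>.\<close>
definition f_part ::
    "('a, 'b, 'e::euclidean_space, 'd::euclidean_space) lightlike_data \<Rightarrow> 'b \<Rightarrow> 'e \<Rightarrow> 'e" where
  "f_part L x v = component (TM L x) (tr L x) (JM L x v)"

definition w_part ::
    "('a, 'b, 'e::euclidean_space, 'd::euclidean_space) lightlike_data \<Rightarrow> 'b \<Rightarrow> 'e \<Rightarrow> 'e" where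
  "w_part L x v = component (tr L x) (TM L x) (JM L x v)"

definition Bo :: "('a, 'b, 'e, 'd) lightlike_data \<Rightarrow> 'b \<Rightarrow> 'e set" where
  "Bo L x = JM L x ` scr L x \<inter> scr L x"

definition B' :: "('a, 'b, 'e, 'd) lightlike_data \<Rightarrow> 'b \<Rightarrow> 'e set" where
  "B' L x = scr L x \<inter> orth_compl (gM L x) (Bo L x)"

text \<open>\<open>B' \<noteq> {0}\<close> and the (non-)inclusions of \<open>J(B')\<close> are read as statements about bundles.\<close>
definition screen_generic ::
    "('a::topological_space, 'b::topological_space, 'e::euclidean_space, 'd::euclidean_space)
       lightlike_data \<Rightarrow> bool" where
  "screen_generic L \<longleftrightarrow>
     (\<forall>x. JM L x ` RadTM L x = RadTM L x) \<and>
     (\<exists>k. smooth_subbundle (amb L) (incl L) k (Bo L)) \<and>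
     (\<forall>x. nondegenerate_on (gM L x) (Bo L x)) \<and>
     (\<exists>k. smooth_subbundle (amb L) (incl L) k (B' L)) \<and>
     (\<forall>x. nondegenerate_on (gM L x) (B' L x)) \<and>
     (\<forall>x. orth_direct_sum (gM L x) (scr L x) (Bo L x) (B' L x)) \<and>
     ((\<exists>x. B' L x \<noteq> {0}) \<longrightarrow>
        \<not> (\<forall>x. JM L x ` B' L x \<subseteq> scr L x) \<and> \<not> (\<forall>x. JM L x ` B' L x \<subseteq> scr_perp L x)) \<and>
     (\<forall>Y\<in>\<Gamma> L (B' L). (\<lambda>x. f_part L x (Y x)) \<in> \<Gamma> L (B' L) \<and>
                        (\<lambda>x. w_part L x (Y x)) \<in> \<Gamma> L (scr_perp L))"


section \<open>Induced objects of the $(l,m)$-type connection\<close>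

definition lm_data ::
    "('a::topological_space, 'b, 'e::euclidean_space, 'd) lightlike_data \<Rightarrow> bool" where
  "lm_data L \<longleftrightarrow> smooth_fun (amb L) (coef_l L) \<and> smooth_fun (amb L) (coef_m L) \<and>
     (coef_l L, coef_m L) \<noteq> ((\<lambda>_. 0), (\<lambda>_. 0)) \<and>
     smooth_vf (amb L) (eta L) \<and> (\<forall>p. metric L p (eta L p) (eta L p) = 1)"

definition Omega_bar ::
    "('a::topological_space, 'b::topological_space, 'e::euclidean_space, 'd) lightlike_data \<Rightarrow>
     ('b \<Rightarrow> 'e) \<Rightarrow> ('b \<Rightarrow> 'e) \<Rightarrow> 'b \<Rightarrow> 'e" where
  "Omega_bar L X Y x =
     connection_along (amb L) (incl L)
       (lm_connection (metric L) (bronze L) (levi L) (coef_l L) (coef_m L) (eta L)) x (X x) Y"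

definition Omega ::
    "('a::topological_space, 'b::topological_space, 'e::euclidean_space, 'd::euclidean_space)
       lightlike_data \<Rightarrow> ('b \<Rightarrow> 'e) \<Rightarrow> ('b \<Rightarrow> 'e) \<Rightarrow> 'b \<Rightarrow> 'e" where
  "Omega L X Y x = component (TM L x) (tr L x) (Omega_bar L X Y x)"

definition h_s ::
    "('a::topological_space, 'b::topological_space, 'e::euclidean_space, 'd::euclidean_space)
       lightlike_data \<Rightarrow> ('b \<Rightarrow> 'e) \<Rightarrow> ('b \<Rightarrow> 'e) \<Rightarrow> 'b \<Rightarrow> 'e" where
  "h_s L X Y x =
     component (scr_perp L x) {u + v |u v. u \<in> TM L x \<and> v \<in> ltr L x} (Omega_bar L X Y x)"

definition Omega_star ::
    "('a::topological_space, 'b::topological_space, 'e::euclidean_space, 'd::euclidean_space)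
       lightlike_data \<Rightarrow> ('b \<Rightarrow> 'e) \<Rightarrow> ('b \<Rightarrow> 'e) \<Rightarrow> 'b \<Rightarrow> 'e" where
  "Omega_star L X Y x = component (scr L x) (RadTM L x) (Omega L X Y x)"

definition h_star ::
    "('a::topological_space, 'b::topological_space, 'e::euclidean_space, 'd::euclidean_space)
       lightlike_data \<Rightarrow> ('b \<Rightarrow> 'e) \<Rightarrow> ('b \<Rightarrow> 'e) \<Rightarrow> 'b \<Rightarrow> 'e" where
  "h_star L X Y x = component (RadTM L x) (scr L x) (Omega L X Y x)"

text \<open>\<open>\<Omega>\<^sub>X Y\<close> is automatically smooth for smooth \<open>X\<close> and \<open>Y\<close>, so being a section of \<open>E\<close> is a
  pointwise condition.\<close>
definition parallel_distribution ::
    "('a::topological_space, 'b::topological_space, 'e::euclidean_space, 'd::euclidean_space)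
       lightlike_data \<Rightarrow> ('b \<Rightarrow> 'e set) \<Rightarrow> bool" where
  "parallel_distribution L E \<longleftrightarrow> (\<forall>X\<in>\<Gamma> L E. \<forall>Y\<in>\<Gamma> L E. \<forall>x. Omega L X Y x \<in> E x)"

end

theory Submission
  imports Defs
begin

text \<open>Let \<open>X\<close>, \<open>Y\<close> be sections of \<open>B\<^sub>o\<close> and \<open>Z\<close> one of \<open>B'\<close>. As \<open>B\<^sub>o\<close> is \<open>J\<close>-invariant, the extra term of the
  \<open>(l,m)\<close>-type connection lies in \<open>B\<^sub>o\<close> and is orthogonal to \<open>Z\<close> and \<open>J Z\<close>. With \<open>\<nabla> J = 0\<close> and
  \<open>J\<^sup>2 = 3 J + I\<close> this gives \<open>g(\<Omega>\<^sub>X J Y, J Z) - 3 g(\<Omega>\<^sub>X J Y, Z) = g(\<Omega>\<^sub>X Y, Z)\<close> for the ambient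
  connection, and splitting the left-hand side into components shows that (ii) says
  \<open>g(\<Omega>\<^sub>X Y, Z) = 0\<close>. Condition (i) says \<open>(J - 3) h\<^sup>*(X, J Y) = 0\<close>; since \<open>J - 3\<close> is the inverse of \<open>J\<close> and
  every section of \<open>B\<^sub>o\<close> is of the form \<open>J Y\<close>, it amounts to the vanishing of \<open>h\<^sup>*\<close> on \<open>B\<^sub>o\<close>. To pass
  from sections to single vectors, bump functions produce global sections of \<open>B'\<close> and \<open>ltr(TM)\<close>
  through the vectors of local frames.\<close>

section \<open>Functions of class $C^k$ and flat functions\<close>

text \<open>A Frechet derivative sees only the germ of a function. As \<open>S\<close> is open,
  agreement on \<open>S\<close> is agreement near each of its points, so the derivatives agree on
  \<open>S\<close> too and the induction repeats.\<close>

lemma Ck_on_cong: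
  assumes "open S" "\<And>x. x \<in> S \<Longrightarrow> f x = g x" "Ck_on k S f"
  shows "Ck_on k S g"
  using assms(2,3)
proof (induction k arbitrary: f g)
  case 0
  then show ?case by (simp cong: continuous_on_cong)
next
  case (Suc k)
  have "g differentiable (at x)" if "x \<in> S" for x
    using Suc.prems that assms(1)
    by (meson Ck_on.simps(2) differentiable_def has_derivative_transform_within_open)
  moreover have "Ck_on k S (\<lambda>x. frechet_derivative g (at x) v)" for v
  proof (rule Suc.IH)
    show "Ck_on k S (\<lambda>x. frechet_derivative f (at x) v)" using Suc.prems by simp
    show "frechet_derivative f (at x) v = frechet_derivative g (at x) v" if "x \<in> S" for x
      using frechet_derivative_transform_within_open[of f x S g] Suc.prems that assms(1) by simp
  qed
  ultimately show ?case by simp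
qed

text \<open>Continuity and differentiability are conditions at single points, so each level of the
  induction can borrow them from the neighbourhood \<open>T\<close>. This glues the two descriptions
  of a bump function.\<close>

lemma Ck_on_local:
  assumes "\<And>x. x \<in> S \<Longrightarrow> \<exists>T. open T \<and> x \<in> T \<and> Ck_on k T f"
  shows "Ck_on k S f"
  using assms
proof (induction k arbitrary: f)
  case 0
  have "isCont f x" if "x \<in> S" for x
    using 0[OF that] by (auto simp: continuous_on_eq_continuous_at)
  then show ?case by (simp add: continuous_at_imp_continuous_on)
next
  case (Suc k)
  have "f differentiable (at x)" if "x \<in> S" for x
    using Suc.prems[OF that] by auto
  moreover have "Ck_on k S (\<lambda>x. frechet_derivative f (at x) v)" for v
  proof (rule Suc.IH)
    show "\<exists>T. open T \<and> x \<in> T \<and> Ck_on k T (\<lambda>x. frechet_derivative f (at x) v)" if "x \<in> S" for x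
      using Suc.prems[OF that] by auto
  qed
  ultimately show ?case by simp
qed

text \<open>\<open>Ck_on (Suc k)\<close> constrains only the first derivatives, so that the classes
  decrease takes an induction. The product rule relies on it for the factor left
  undifferentiated.\<close>

lemma Ck_on_SucD: "Ck_on (Suc k) S f \<Longrightarrow> Ck_on k S f"
proof (induction k arbitrary: f)
  case 0
  then show ?case
    by (auto intro!: continuous_at_imp_continuous_on differentiable_imp_continuous_within)
next
  case (Suc k)
  then show ?case by (metis Ck_on.simps(2))
qed

lemma Ck_on_const: "Ck_on k S (\<lambda>_. c)"
  by (induction k arbitrary: c) simp_all

lemma Ck_on_add:
  assumes "open S" "Ck_on k S f" "Ck_on k S g"
  shows "Ck_on k S (\<lambda>x. f x + g x)"
  using assms(2,3)
proof (induction k arbitrary: f g)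
  case 0
  then show ?case by (simp add: continuous_on_add)
next
  case (Suc k)
  have "Ck_on k S (\<lambda>x. frechet_derivative (\<lambda>x. f x + g x) (at x) v)" for v
  proof (rule Ck_on_cong[OF assms(1)])
    show "Ck_on k S (\<lambda>x. frechet_derivative f (at x) v + frechet_derivative g (at x) v)"
      using Suc by simp
    show "frechet_derivative f (at x) v + frechet_derivative g (at x) v
        = frechet_derivative (\<lambda>x. f x + g x) (at x) v" if "x \<in> S" for x
    proof -
      have "((\<lambda>x. f x + g x) has_derivative
          (\<lambda>v. frechet_derivative f (at x) v + frechet_derivative g (at x) v)) (at x)"
        using Suc.prems that by (auto intro!: has_derivative_add simp: frechet_derivative_works)
      from frechet_derivative_at[OF this] show ?thesis by (metis)
    qed
  qed
  then show ?case using Suc.prems by simp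
qed

text \<open>Stated for any bounded bilinear map to cover products of functions as well as the inner
  product inside bump functions.\<close>

lemma Ck_on_bilinear:
  assumes "bounded_bilinear b" "open S" "Ck_on k S f" "Ck_on k S g"
  shows "Ck_on k S (\<lambda>x. b (f x) (g x))"
  using assms(3,4)
proof (induction k arbitrary: f g)
  case 0
  then show ?case by (simp add: bounded_bilinear.continuous_on[OF assms(1)])
next
  case (Suc k)
  have d: "((\<lambda>x. b (f x) (g x)) has_derivative
      (\<lambda>v. b (f x) (frechet_derivative g (at x) v) + b (frechet_derivative f (at x) v) (g x))) (at x)"
    if "x \<in> S" for x
    using Suc.prems that
    by (auto intro!: bounded_bilinear.FDERIV[OF assms(1)] simp: frechet_derivative_works[symmetric])
  have "Ck_on k S (\<lambda>x. frechet_derivative (\<lambda>x. b (f x) (g x)) (at x) v)" for v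
  proof (rule Ck_on_cong[OF assms(2)])
    show "Ck_on k S (\<lambda>x. b (f x) (frechet_derivative g (at x) v)
        + b (frechet_derivative f (at x) v) (g x))"
      using Suc.prems(1,2)[THEN Ck_on_SucD] Suc.prems by (intro Ck_on_add[OF assms(2)] Suc.IH) auto
    show "b (f x) (frechet_derivative g (at x) v) + b (frechet_derivative f (at x) v) (g x)
        = frechet_derivative (\<lambda>x. b (f x) (g x)) (at x) v" if "x \<in> S" for x
      using frechet_derivative_at[OF d[OF that]] by metis
  qed
  moreover have "(\<lambda>x. b (f x) (g x)) differentiable (at x)" if "x \<in> S" for x
    using d[OF that] differentiable_def by blast
  ultimately show ?case by simp
qed

text \<open>Functions \<open>P(1/t) exp(-1/t)\<close>, cut off at \<open>0\<close>: a class closed under differentiation.\<close>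
definition flat :: "real poly \<Rightarrow> real \<Rightarrow> real" where
  "flat P t = (if 0 < t then poly P (inverse t) * exp (- inverse t) else 0)"

text \<open>From the right, s = 1/t turns the claim into P(s) exp(-s) -> 0 at infinity, where the
  exponential beats each monomial; from the left the function is 0.\<close>

lemma flat_tendsto_0: "(flat P \<longlongrightarrow> 0) (at 0)"
proof -
  have "((\<lambda>s. poly P s * exp (- s)) \<longlongrightarrow> (0::real)) at_top"
  proof -
    have "((\<lambda>s::real. \<Sum>i\<le>degree P. coeff P i * (s ^ i / exp s)) \<longlongrightarrow> (\<Sum>i\<le>degree P. coeff P i * 0)) at_top"
      by (intro tendsto_intros tendsto_power_div_exp_0)
    then show ?thesis
      by (simp add: poly_altdef sum_distrib_right exp_minus divide_inverse mult.assoc)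
  qed
  then have "((\<lambda>t. poly P (inverse t) * exp (- inverse t)) \<longlongrightarrow> 0) (at_right (0::real))"
    by (rule filterlim_compose[OF _ filterlim_inverse_at_top_right])
  then have "(flat P \<longlongrightarrow> 0) (at_right 0)"
    by (rule Lim_transform_eventually) (auto simp: flat_def eventually_at_filter)
  moreover have "(flat P \<longlongrightarrow> 0) (at_left 0)"
    by (rule Lim_transform_eventually[OF tendsto_const]) (auto simp: flat_def eventually_at_filter)
  ultimately show ?thesis by (simp add: filterlim_split_at)
qed

text \<open>With s = 1/t one has ds/dt = -s^2, and d/ds (P exp(-s)) = (P' - P) exp(-s). The product
  is s^2 (P - P') exp(-s), with \<open>monom 1 2\<close> for s^2.\<close>

lemma flat_has_derivative:
  "(flat P has_real_derivative flat (monom 1 2 * (P - pderiv P)) t) (at t)"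
proof (cases t "0::real" rule: linorder_cases)
  case less
  have "((\<lambda>_. 0) has_real_derivative 0) (at t)" by simp
  then have "(flat P has_real_derivative 0) (at t)"
    by (rule has_field_derivative_transform_within_open[where S="{..<0}"])
       (use less in \<open>auto simp: flat_def\<close>)
  then show ?thesis using less by (simp add: flat_def)
next
  case equal
  \<comment> \<open>Dividing by h multiplies the polynomial by its variable, so the difference
    quotient at 0 is again a flat function and tends to 0.\<close>
  have "(\<lambda>h. (flat P (0 + h) - flat P 0) / h) = (\<lambda>h. flat (pCons 0 P) h)"
    by (auto simp: flat_def fun_eq_iff divide_inverse)
  then have "(flat P has_real_derivative 0) (at 0)"
    using flat_tendsto_0[of "pCons 0 P"] by (simp only: DERIV_def)
  then show ?thesis by (simp add: equal flat_def)
next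
  case greater
  have "((\<lambda>t. poly P (inverse t) * exp (- inverse t)) has_real_derivative
      flat (monom 1 2 * (P - pderiv P)) t) (at t)"
    using greater
    by (auto intro!: derivative_eq_intros poly_DERIV[THEN DERIV_chain2] simp: flat_def poly_monom field_simps power2_eq_square)
  then show ?thesis
    by (rule has_field_derivative_transform_within_open[where S="{0<..}"])
       (use greater in \<open>auto simp: flat_def\<close>)
qed

text \<open>\<open>P\<close> has to vary in the induction, as each derivative replaces it by another
  polynomial.\<close>

lemma Ck_on_flat:
  assumes "open S" "Ck_on k S u"
  shows "Ck_on k S (\<lambda>x. flat P (u x))"
  using assms(2)
proof (induction k arbitrary: P)
  case 0
  have "continuous_on UNIV (flat P)"
    by (meson DERIV_isCont continuous_at_imp_continuous_on flat_has_derivative)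
  then show ?case using 0 continuous_on_compose2 by fastforce
next
  case (Suc k)
  let ?Q = "monom 1 2 * (P - pderiv P)"
  have d: "((\<lambda>x. flat P (u x)) has_derivative
      (\<lambda>v. frechet_derivative u (at x) v * flat ?Q (u x))) (at x)"
    if "x \<in> S" for x
  proof -
    have "(flat P has_derivative (\<lambda>h. flat ?Q (u x) * h)) (at (u x))"
      using flat_has_derivative[of P "u x"] by (simp add: has_field_derivative_def)
    moreover have "(u has_derivative frechet_derivative u (at x)) (at x)"
      using Suc.prems that by (simp add: frechet_derivative_works)
    ultimately show ?thesis
      using has_derivative_compose[of u "frechet_derivative u (at x)" x UNIV "flat P"]
      by (simp add: mult.commute)
  qed
  have "Ck_on k S (\<lambda>x. frechet_derivative (\<lambda>x. flat P (u x)) (at x) v)" for v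
  proof (rule Ck_on_cong[OF assms(1)])
    show "Ck_on k S (\<lambda>x. frechet_derivative u (at x) v * flat ?Q (u x))"
      using Suc.prems Ck_on_SucD[OF Suc.prems]
      by (intro Ck_on_bilinear[OF bounded_bilinear_mult assms(1)] Suc.IH) auto
    show "frechet_derivative u (at x) v * flat ?Q (u x)
        = frechet_derivative (\<lambda>x. flat P (u x)) (at x) v" if "x \<in> S" for x
      using frechet_derivative_at[OF d[OF that]] by metis
  qed
  moreover have "(\<lambda>x. flat P (u x)) differentiable (at x)" if "x \<in> S" for x
    using d[OF that] differentiable_def by blast
  ultimately show ?case by simp
qed

section \<open>Bump functions and sections along a submanifold\<close>

lemma is_chart_homeomorphism:
  "is_chart c \<Longrightarrow> homeomorphism (fst c) (snd c ` fst c) (snd c) (coord_inv c)"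
  by (simp add: is_chart_def)

lemma coord_inv_apply: "is_chart c \<Longrightarrow> x \<in> fst c \<Longrightarrow> coord_inv c (snd c x) = x"
  by (meson homeomorphism_apply1 is_chart_homeomorphism)

lemma open_chart_image:
  assumes "is_chart c" "open V"
  shows "open (snd c ` (fst c \<inter> V))"
proof -
  have "snd c ` (fst c \<inter> V) = snd c ` fst c \<inter> coord_inv c -` V"
    using assms by (auto simp: coord_inv_apply)
  moreover have "open (snd c ` fst c \<inter> coord_inv c -` V)"
    using assms by (intro continuous_open_preimage) (auto simp: is_chart_def homeomorphism_def)
  ultimately show ?thesis by simp
qed

lemma open_coord_inv_image:
  assumes "is_chart c" "W \<subseteq> snd c ` fst c" "open W"
  shows "open (coord_inv c ` W)"
proof -
  have "coord_inv c ` W = fst c \<inter> snd c -` W"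
  proof (intro equalityI subsetI)
    fix x assume "x \<in> coord_inv c ` W"
    then obtain z where "z \<in> fst c" "snd c z \<in> W" "x = coord_inv c (snd c z)"
      using assms(2) by blast
    then show "x \<in> fst c \<inter> snd c -` W" using assms(1) by (simp add: coord_inv_apply)
  next
    fix x assume "x \<in> fst c \<inter> snd c -` W"
    then show "x \<in> coord_inv c ` W"
      using coord_inv_apply[OF assms(1), of x] by (metis IntD1 IntD2 image_eqI vimageD)
  qed
  moreover have "open (fst c \<inter> snd c -` W)"
    using assms by (intro continuous_open_preimage) (auto simp: is_chart_def homeomorphism_def)
  ultimately show ?thesis by simp
qed

lemma compact_coord_inv_image:
  assumes "is_chart c" "K \<subseteq> snd c ` fst c" "compact K"
  shows "compact (coord_inv c ` K)"
  using assms unfolding is_chart_def homeomorphism_def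
  by (meson compact_continuous_image continuous_on_subset)

lemma smooth_atlas_is_chart: "smooth_atlas A \<Longrightarrow> c \<in> A \<Longrightarrow> is_chart c"
  by (simp add: smooth_atlas_def)

lemma chart_at:
  assumes "smooth_atlas A"
  shows "chart_at A p \<in> A" "p \<in> fst (chart_at A p)" "is_chart (chart_at A p)"
proof -
  have "p \<in> (\<Union>c\<in>A. fst c)" using assms by (simp add: smooth_atlas_def)
  then have "\<exists>c. c \<in> A \<and> p \<in> fst c" by blast
  then have "chart_at A p \<in> A \<and> p \<in> fst (chart_at A p)"
    unfolding chart_at_def by (rule someI_ex)
  then show "chart_at A p \<in> A" "p \<in> fst (chart_at A p)" "is_chart (chart_at A p)"
    using assms by (auto simp: smooth_atlas_def)
qed

section \<open>Smooth functions and vector fields in charts\<close>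

lemma smooth_on_differentiable: "smooth_on S f \<Longrightarrow> x \<in> S \<Longrightarrow> f differentiable (at x)"
  unfolding smooth_on_def by (metis Ck_on.simps(2))

lemma smooth_fun_has_derivative:
  assumes "smooth_atlas A" "smooth_fun A f"
  shows "((f \<circ> coord_inv (chart_at A p)) has_derivative (\<lambda>v. deriv_along A p v f))
    (at (snd (chart_at A p) p))"
proof -
  have "(f \<circ> coord_inv (chart_at A p)) differentiable (at (snd (chart_at A p) p))"
    using assms chart_at[OF assms(1), of p]
    by (intro smooth_on_differentiable[of "snd (chart_at A p) ` fst (chart_at A p)"])
       (auto simp: smooth_fun_def)
  then show ?thesis by (simp add: deriv_along_def frechet_derivative_works eta_contract_eq)
qed

lemma linear_deriv_along:
  assumes "smooth_atlas A" "smooth_fun A f"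
  shows "linear (\<lambda>v. deriv_along A p v f)"
  using smooth_fun_has_derivative[OF assms] by (rule has_derivative_linear)

lemma smooth_fun_const: "smooth_fun A (\<lambda>_. c)"
  by (simp add: smooth_fun_def smooth_on_def o_def Ck_on_const)

lemma smooth_fun_add:
  assumes "smooth_atlas A" "smooth_fun A f" "smooth_fun A h"
  shows "smooth_fun A (\<lambda>p. f p + h p)"
proof -
  have "Ck_on k (snd c ` fst c) (\<lambda>x. f (coord_inv c x) + h (coord_inv c x))" if "c \<in> A" for k c
    using assms that smooth_atlas_is_chart[OF assms(1) that]
    by (intro Ck_on_add) (simp_all add: smooth_fun_def smooth_on_def o_def is_chart_def)
  then show ?thesis by (simp add: smooth_fun_def smooth_on_def o_def)
qed

lemma smooth_fun_mult:
  assumes "smooth_atlas A" "smooth_fun A f" "smooth_fun A h"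
  shows "smooth_fun A (\<lambda>p. f p * h p)"
proof -
  have "Ck_on k (snd c ` fst c) (\<lambda>x. f (coord_inv c x) * h (coord_inv c x))" if "c \<in> A" for k c
    using assms that smooth_atlas_is_chart[OF assms(1) that]
    by (intro Ck_on_bilinear[OF bounded_bilinear_mult]) (simp_all add: smooth_fun_def smooth_on_def o_def is_chart_def)
  then show ?thesis by (simp add: smooth_fun_def smooth_on_def o_def)
qed

lemma smooth_vf_add:
  assumes "smooth_atlas A" "smooth_vf A X" "smooth_vf A Y"
  shows "smooth_vf A (\<lambda>p. X p + Y p)"
  using assms by (simp add: smooth_vf_def linear_add[OF linear_deriv_along] smooth_fun_add)

lemma smooth_vf_scaleR:
  assumes "smooth_atlas A" "smooth_fun A \<phi>" "smooth_vf A X"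
  shows "smooth_vf A (\<lambda>p. \<phi> p *\<^sub>R X p)"
  using assms by (simp add: smooth_vf_def linear_scale[OF linear_deriv_along] smooth_fun_mult)

lemma smooth_vf_zero:
  assumes "smooth_atlas A"
  shows "smooth_vf A (\<lambda>_. 0)"
  using assms by (simp add: smooth_vf_def linear_0[OF linear_deriv_along] smooth_fun_const)

text \<open>The bump vanishes on an open \<open>T\<close> around \<open>C\<close>, not just on
  \<open>C\<close>: a field multiplied by it is then zero near the points of \<open>C\<close>, which
  is what a local extension by 0 asks for.\<close>

lemma smooth_bump:
  fixes A :: "('a::{t2_space, second_countable_topology}, 'e::euclidean_space) chart set"
  assumes A: "smooth_atlas A" and "closed C" "p \<notin> C"
  obtains \<phi> T where "smooth_fun A \<phi>" "\<phi> p = 1" "open T" "C \<subseteq> T" "\<And>q. q \<in> T \<Longrightarrow> \<phi> q = 0"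
proof -
  define c where "c = chart_at A p"
  have c: "c \<in> A" "p \<in> fst c" "is_chart c"
    unfolding c_def using chart_at[OF A] by auto
  define a where "a = snd c p"
  have "open (snd c ` (fst c \<inter> - C))" "a \<in> snd c ` (fst c \<inter> - C)"
    using open_chart_image[OF c(3), of "- C"] assms c by (auto simp: a_def)
  then obtain r where r: "0 < r" "cball a r \<subseteq> snd c ` (fst c \<inter> - C)"
    by (meson open_contains_cball)
  define K where "K = coord_inv c ` cball a r"
  \<comment> \<open>Compactness makes \<open>K\<close> closed in the whole Hausdorff space, so the
    extension by 0 beyond the chart domain stays smooth at the edge of that domain.\<close>
  have "compact K" unfolding K_def
    using r by (intro compact_coord_inv_image[OF c(3)]) auto
  then have K: "closed K" by (rule compact_imp_closed)
  have KC: "K \<subseteq> fst c - C" using r(2) by (auto simp: K_def coord_inv_apply[OF c(3)])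
  \<comment> \<open>\<open>u\<close> is r^2 - |y - a|^2, positive exactly inside the ball; it is
    spelled with sums and a factor -1 to match the closure rules for \<open>Ck_on\<close>. The
    constant \<open>P\<close> normalises the value at \<open>p\<close> to 1.\<close>
  define u where "u y = r\<^sup>2 + (-1) * ((y + - a) \<bullet> (y + - a))" for y
  define P where "P = [:exp (inverse (r\<^sup>2)):]"
  define \<phi> where "\<phi> q = (if q \<in> fst c then flat P (u (snd c q)) else 0)" for q
  have zero: "\<phi> q = 0" if "q \<notin> K" for q
  proof (cases "q \<in> fst c")
    case True
    then have "snd c q \<notin> cball a r"
      using that coord_inv_apply[OF c(3)] unfolding K_def by (metis image_eqI)
    then have "r\<^sup>2 < (snd c q - a) \<bullet> (snd c q - a)"
      using r(1) by (simp add: dist_norm norm_minus_commute dot_square_norm power_strict_mono)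
    then show ?thesis by (simp add: \<phi>_def flat_def u_def)
  qed (simp add: \<phi>_def)
  have "Ck_on k (snd c' ` fst c') (\<phi> \<circ> coord_inv c')" if c': "c' \<in> A" for k c'
  proof (rule Ck_on_local)
    fix x assume "x \<in> snd c' ` fst c'"
    then obtain q where q: "q \<in> fst c'" "x = snd c' q" by auto
    have ch: "is_chart c'" using A c' by (rule smooth_atlas_is_chart)
    show "\<exists>T. open T \<and> x \<in> T \<and> Ck_on k T (\<phi> \<circ> coord_inv c')"
    \<comment> \<open>The domain of \<open>c\<close> and the complement of \<open>K\<close> cover
      the manifold: on the first the bump is a flat function after a transition map, on the second
      it is 0.\<close>
    proof (cases "q \<in> fst c")
      case True
      let ?T = "snd c' ` (fst c' \<inter> fst c)"
      let ?\<tau> = "snd c \<circ> coord_inv c'"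
      have o: "open ?T" using open_chart_image[OF ch] c(3) by (simp add: is_chart_def)
      have "Ck_on k ?T ?\<tau>" using A c(1) c' by (simp add: smooth_atlas_def smooth_on_def)
      then have d: "Ck_on k ?T (\<lambda>y. ?\<tau> y + - a)"
        by (intro Ck_on_add o Ck_on_const)
      then have "Ck_on k ?T (\<lambda>y. flat P (u (?\<tau> y)))"
        unfolding u_def
        by (intro Ck_on_flat[OF o] Ck_on_add[OF o] Ck_on_const
            Ck_on_bilinear[OF bounded_bilinear_mult o] Ck_on_bilinear[OF bounded_bilinear_inner o d d])
      then have "Ck_on k ?T (\<phi> \<circ> coord_inv c')"
        by (rule Ck_on_cong[OF o, rotated]) (auto simp: \<phi>_def coord_inv_apply[OF ch])
      then show ?thesis using o q True by blast
    next
      case False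
      let ?T = "snd c' ` (fst c' \<inter> - K)"
      have o: "open ?T" using open_chart_image[OF ch] K by (simp add: open_Compl)
      have "Ck_on k ?T (\<phi> \<circ> coord_inv c')"
        by (rule Ck_on_cong[OF o _ Ck_on_const[of _ _ 0]]) (auto simp: zero coord_inv_apply[OF ch])
      moreover have "x \<in> ?T" using q False KC by auto
      ultimately show ?thesis using o by blast
    qed
  qed
  then have "smooth_fun A \<phi>" by (simp add: smooth_fun_def smooth_on_def)
  moreover have "\<phi> p = 1"
    using r(1) c by (simp add: \<phi>_def u_def a_def flat_def P_def exp_minus)
  moreover have "C \<subseteq> - K" using KC by auto
  ultimately show thesis using that[of \<phi> "- K"] K zero by (simp add: open_Compl)
qed

text \<open>A vector in the range of the tangent map is a velocity inside the submanifold. By the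
  chain rule the derivative along it is one of \<open>f \<circ> \<iota>\<close>, which coincides
  with \<open>h \<circ> \<iota>\<close> near \<open>x\<close>.\<close>

lemma deriv_along_tangent_cong:
  assumes A: "smooth_atlas A" and B: "smooth_atlas B" and i: "smooth_map B A \<iota>"
    and f: "smooth_fun A f" "smooth_fun A h"
    and U: "open U" "x \<in> U" "\<And>y. y \<in> U \<Longrightarrow> f (\<iota> y) = h (\<iota> y)"
    and v: "v \<in> range (tangent_map B A \<iota> x)"
  shows "deriv_along A (\<iota> x) v f = deriv_along A (\<iota> x) v h"
proof -
  define c where "c = chart_at A (\<iota> x)"
  define b where "b = chart_at B x"
  define G where "G = snd c \<circ> \<iota> \<circ> coord_inv b"
  have c: "c \<in> A" "\<iota> x \<in> fst c" "is_chart c" unfolding c_def using chart_at[OF A] by auto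
  have b: "b \<in> B" "x \<in> fst b" "is_chart b" unfolding b_def using chart_at[OF B] by auto
  let ?a = "snd b x"
  have Ga: "G ?a = snd c (\<iota> x)" by (simp add: G_def coord_inv_apply b)
  have "G differentiable (at ?a)"
    using i b c unfolding smooth_map_def G_def
    by (intro smooth_on_differentiable[of "snd b ` (fst b \<inter> \<iota> -` fst c)"]) auto
  then have G: "(G has_derivative tangent_map B A \<iota> x) (at ?a)"
    unfolding tangent_map_def G_def b_def c_def by (simp add: frechet_derivative_works eta_contract_eq)
  have comp: "((e \<circ> coord_inv c \<circ> G) has_derivative (\<lambda>w. deriv_along A (\<iota> x) (tangent_map B A \<iota> x w) e)) (at ?a)"
    if "smooth_fun A e" for e
    using diff_chain_at[OF G, of "e \<circ> coord_inv c" "\<lambda>v. deriv_along A (\<iota> x) v e"]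
      smooth_fun_has_derivative[OF A that, of "\<iota> x"] by (simp add: Ga c_def o_def)
  let ?O = "snd b ` (fst b \<inter> (U \<inter> \<iota> -` fst c))"
  have "open (\<iota> -` fst c)"
    using i c by (auto simp: smooth_map_def is_chart_def intro: open_vimage)
  then have "open ?O" using U by (intro open_chart_image b) auto
  moreover have "?a \<in> ?O" using b c U by auto
  moreover have "(f \<circ> coord_inv c \<circ> G) y = (h \<circ> coord_inv c \<circ> G) y" if "y \<in> ?O" for y
    using that U(3) b c by (auto simp: G_def coord_inv_apply)
  ultimately have "((h \<circ> coord_inv c \<circ> G) has_derivative
      (\<lambda>w. deriv_along A (\<iota> x) (tangent_map B A \<iota> x w) f)) (at ?a)"
    by (rule has_derivative_transform_within_open[OF comp[OF f(1)]])
  from has_derivative_unique[OF this comp[OF f(2)]] v show ?thesis by (auto dest: fun_cong)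
qed

lemma smooth_alongE:
  assumes "smooth_along A \<iota> X"
  obtains X' U where "smooth_vf A X'" "open U" "x \<in> U" "\<And>y. y \<in> U \<Longrightarrow> X' (\<iota> y) = X y"
  using assms unfolding smooth_along_def local_extension_def by blast

text \<open>The topology of \<open>M\<close> may be finer than the induced one, so the support of an ambient bump
  function can meet \<open>M\<close> outside the given neighbourhood. Instead, the bump vanishes near the image of
  a small coordinate sphere around \<open>x\<close>, and the field is cut off to \<open>0\<close> outside that sphere; thus the
  local extensions exist without any straightening of \<open>M\<close>.\<close>
lemma section_through:
  fixes A :: "('a::{t2_space, second_countable_topology}, 'e::euclidean_space) chart set"
    and B :: "('b::{t2_space, second_countable_topology}, 'd::euclidean_space) chart set"
  assumes A: "smooth_atlas A" and B: "smooth_atlas B" and i: "smooth_map B A \<iota>" "inj \<iota>"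
    and U: "open U" "x \<in> U" "\<And>y. y \<in> U \<Longrightarrow> s y \<in> E y"
    and s: "smooth_along A \<iota> s" and E: "\<And>y. subspace (E y)"
  obtains Z where "Z \<in> sections A \<iota> E" "Z x = s x"
proof -
  define b where "b = chart_at B x"
  have b: "x \<in> fst b" "is_chart b" unfolding b_def using chart_at[OF B] by auto
  define a where "a = snd b x"
  have "open (snd b ` (fst b \<inter> U))" "a \<in> snd b ` (fst b \<inter> U)"
    using open_chart_image[OF b(2) U(1)] U b by (auto simp: a_def)
  then obtain r where r: "0 < r" "cball a r \<subseteq> snd b ` (fst b \<inter> U)"
    by (meson open_contains_cball)
  have "cball a r \<subseteq> snd b ` fst b" using r(2) by blast
  then have sub: "cball a r \<subseteq> snd b ` fst b" "ball a r \<subseteq> snd b ` fst b" "sphere a r \<subseteq> snd b ` fst b"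
    using ball_subset_cball sphere_cball by blast+
  let ?K = "coord_inv b ` cball a r" and ?V = "coord_inv b ` ball a r"
    and ?F = "coord_inv b ` sphere a r"
  have K: "closed ?K" by (intro compact_imp_closed compact_coord_inv_image b sub compact_cball)
  have V: "open ?V" by (intro open_coord_inv_image b sub open_ball)
  have F: "compact ?F" by (intro compact_coord_inv_image b sub compact_sphere)
  have ci: "continuous_on UNIV \<iota>" using i by (simp add: smooth_map_def)
  \<comment> \<open>Being compact, the image of the sphere is closed in the ambient space, although
    \<open>\<iota>\<close> need not send closed sets to closed sets; so an ambient bump can separate
    it from \<open>\<iota> x\<close>.\<close>
  have "compact (\<iota> ` ?F)" using F ci by (meson compact_continuous_image continuous_on_subset subset_UNIV)
  then have "closed (\<iota> ` ?F)" by (rule compact_imp_closed)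
  moreover have xF: "x \<notin> ?F"
  proof
    assume "x \<in> ?F"
    then obtain y where y: "y \<in> sphere a r" "x = coord_inv b y" by auto
    then obtain z where "z \<in> fst b" "y = snd b z" using sub(3) by auto
    then have "y = a" using y b by (simp add: a_def coord_inv_apply)
    then show False using y r by simp
  qed
  then have "\<iota> x \<notin> \<iota> ` ?F" using i(2) by (auto dest: injD)
  ultimately obtain \<phi> T where \<phi>: "smooth_fun A \<phi>" "\<phi> (\<iota> x) = 1" "open T" "\<iota> ` ?F \<subseteq> T"
      "\<And>q. q \<in> T \<Longrightarrow> \<phi> q = 0"
    using smooth_bump[OF A] by metis
  define Z where "Z y = (if y \<in> ?V then \<phi> (\<iota> y) *\<^sub>R s y else 0)" for y
  have "cball a r = ball a r \<union> sphere a r" by auto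
  then have KV: "?K = ?V \<union> ?F" by (simp add: image_Un)
  have VU: "?V \<subseteq> U"
  proof -
    have "ball a r \<subseteq> snd b ` (fst b \<inter> U)" using r(2) ball_subset_cball by blast
    then show ?thesis by (auto simp: coord_inv_apply[OF b(2)])
  qed
  have "\<exists>Z'. local_extension A \<iota> y Z Z'" for y
  proof -
    \<comment> \<open>Inside the ball, the bump times a local extension of \<open>s\<close> serves.
      At the sphere both branches of \<open>Z\<close> vanish on the preimage of \<open>T\<close>, so
      0 serves; outside the closed ball \<open>Z\<close> itself is 0.\<close>
    consider "y \<in> ?V" | "y \<in> ?F" | "y \<in> - ?K" using KV by auto
    then show ?thesis
    proof cases
      case 1
      obtain s' W where s': "smooth_vf A s'" "open W" "y \<in> W" "\<And>z. z \<in> W \<Longrightarrow> s' (\<iota> z) = s z"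
        using smooth_alongE[OF s] by metis
      have "local_extension A \<iota> y Z (\<lambda>p. \<phi> p *\<^sub>R s' p)"
        unfolding local_extension_def
        using smooth_vf_scaleR[OF A \<phi>(1) s'(1)] s' 1 V
        by (intro conjI exI[of _ "W \<inter> ?V"]) (auto simp: Z_def)
      then show ?thesis by blast
    next
      case 2
      have "open (\<iota> -` T)" using ci \<phi>(3) by (simp add: open_vimage)
      then have "local_extension A \<iota> y Z (\<lambda>_. 0)"
        unfolding local_extension_def
        using smooth_vf_zero[OF A] 2 \<phi>
        by (intro conjI exI[of _ "\<iota> -` T"]) (auto simp: Z_def)
      then show ?thesis by blast
    next
      case 3
      have "open (- ?K)" using K by blast
      then have "local_extension A \<iota> y Z (\<lambda>_. 0)"
        unfolding local_extension_def
        using smooth_vf_zero[OF A] 3 KV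
        by (intro conjI exI[of _ "- ?K"]) (auto simp: Z_def)
      then show ?thesis by blast
    qed
  qed
  moreover have "Z y \<in> E y" for y
    using U(3) VU E by (auto simp: Z_def subspace_scale subspace_0)
  ultimately have "Z \<in> sections A \<iota> E" by (simp add: sections_def smooth_along_def)
  moreover have "x \<in> ?V" using r(1) b coord_inv_apply by (metis a_def centre_in_ball image_eqI)
  then have "Z x = s x" using \<phi>(2) by (simp add: Z_def)
  ultimately show thesis by (rule that)
qed

lemma smooth_along_add:
  assumes "smooth_atlas A" "smooth_along A \<iota> X" "smooth_along A \<iota> Y"
  shows "smooth_along A \<iota> (\<lambda>x. X x + Y x)"
  unfolding smooth_along_def
proof
  fix x
  obtain X' U where "smooth_vf A X'" "open U" "x \<in> U" "\<And>y. y \<in> U \<Longrightarrow> X' (\<iota> y) = X y"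
    using smooth_alongE[OF assms(2)] by metis
  moreover obtain Y' V where "smooth_vf A Y'" "open V" "x \<in> V" "\<And>y. y \<in> V \<Longrightarrow> Y' (\<iota> y) = Y y"
    using smooth_alongE[OF assms(3)] by metis
  ultimately have "local_extension A \<iota> x (\<lambda>x. X x + Y x) (\<lambda>p. X' p + Y' p)"
    unfolding local_extension_def using smooth_vf_add[OF assms(1)]
    by (intro conjI exI[of _ "U \<inter> V"]) auto
  then show "\<exists>Y'. local_extension A \<iota> x (\<lambda>x. X x + Y x) Y'" by blast
qed

lemma smooth_along_scaleR:
  assumes "smooth_atlas A" "smooth_along A \<iota> X"
  shows "smooth_along A \<iota> (\<lambda>x. c *\<^sub>R X x)"
  unfolding smooth_along_def
proof
  fix x
  obtain X' U where "smooth_vf A X'" "open U" "x \<in> U" "\<And>y. y \<in> U \<Longrightarrow> X' (\<iota> y) = X y"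
    using smooth_alongE[OF assms(2)] by metis
  then have "local_extension A \<iota> x (\<lambda>x. c *\<^sub>R X x) (\<lambda>p. c *\<^sub>R X' p)"
    unfolding local_extension_def using smooth_vf_scaleR[OF assms(1) smooth_fun_const] by auto
  then show "\<exists>Y'. local_extension A \<iota> x (\<lambda>x. c *\<^sub>R X x) Y'" by blast
qed

text \<open>A local frame lies in \<open>E\<close> only over \<open>U\<close>;
  \<open>section_through\<close> replaces each of its fields by a global section with the same value
  at \<open>x\<close>. Spanning the fibre suffices later, as the tested conditions are linear in
  that value.\<close>

lemma local_frame_sections:
  fixes A :: "('a::{t2_space, second_countable_topology}, 'e::euclidean_space) chart set"
    and B :: "('b::{t2_space, second_countable_topology}, 'd::euclidean_space) chart set"
  assumes "smooth_atlas A" "smooth_atlas B" "smooth_map B A \<iota>" "inj \<iota>"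
    and U: "open U" "x \<in> U" and s: "\<forall>i<k. smooth_along A \<iota> (s i)"
    and E: "\<forall>y\<in>U. E y = span ((\<lambda>i. s i y) ` {..<k})" and sub: "\<And>y. subspace (E y)"
  shows "E x \<subseteq> span ((\<lambda>Z. Z x) ` sections A \<iota> E)"
proof -
  have "s i x \<in> (\<lambda>Z. Z x) ` sections A \<iota> E" if "i < k" for i
  proof -
    have "s i y \<in> E y" if "y \<in> U" for y
      using E that \<open>i < k\<close> by (auto intro: span_base)
    moreover have "smooth_along A \<iota> (s i)" using s that by simp
    ultimately obtain Z where "Z \<in> sections A \<iota> E" "Z x = s i x"
      by (rule section_through[OF assms(1-4) U _ _ sub])
    then show ?thesis by (intro image_eqI[of _ _ Z]) simp_all
  qed
  then have "(\<lambda>i. s i x) ` {..<k} \<subseteq> (\<lambda>Z. Z x) ` sections A \<iota> E" by auto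
  then show ?thesis using E U(2) span_mono by metis
qed

text \<open>By metric compatibility, pairing \<open>\<nabla>\<^sub>v Y\<close> with \<open>Z\<close> only involves derivatives of functions along
  tangential directions, which see the extension of \<open>Y\<close> only through its values on \<open>M\<close>.\<close>
lemma levi_civita_extension_indep:
  assumes "smooth_atlas A" "smooth_atlas B" "smooth_map B A \<iota>"
    and g: "semi_riemannian_metric A g q" and lc: "levi_civita A g nabla"
    and Y: "smooth_vf A Y" "smooth_vf A Y'" "open U" "x \<in> U" "\<And>y. y \<in> U \<Longrightarrow> Y (\<iota> y) = Y' (\<iota> y)"
    and Z: "smooth_vf A Z"
    and v: "v \<in> range (tangent_map B A \<iota> x)"
  shows "g (\<iota> x) (nabla (\<iota> x) v Y) (Z (\<iota> x)) = g (\<iota> x) (nabla (\<iota> x) v Y') (Z (\<iota> x))"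
proof -
  have "smooth_fun A (\<lambda>p. g p (V p) (Z p))" if "smooth_vf A V" for V
    using g that Z by (simp add: semi_riemannian_metric_def)
  then have "deriv_along A (\<iota> x) v (\<lambda>p. g p (Y p) (Z p)) = deriv_along A (\<iota> x) v (\<lambda>p. g p (Y' p) (Z p))"
    using Y by (intro deriv_along_tangent_cong[OF assms(1-3) _ _ Y(3,4) _ v]) auto
  moreover have "deriv_along A (\<iota> x) v (\<lambda>p. g p (V p) (Z p))
      = g (\<iota> x) (nabla (\<iota> x) v V) (Z (\<iota> x)) + g (\<iota> x) (V (\<iota> x)) (nabla (\<iota> x) v Z)"
    if "smooth_vf A V" for V
    using lc that Z by (simp add: levi_civita_def)
  ultimately show ?thesis using Y by simp
qed

section \<open>The pointwise splitting of a lightlike submanifold\<close>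

lemma component_eqI:
  assumes "subspace E" "subspace F" "E \<inter> F = {0}" "u \<in> E" "v - u \<in> F"
  shows "component E F v = u"
  unfolding component_def
proof (rule the_equality)
  fix u' assume u': "u' \<in> E \<and> v - u' \<in> F"
  have "u' - u \<in> E" using assms u' by (simp add: subspace_diff)
  moreover have "(v - u) - (v - u') \<in> F" using assms u' by (blast intro: subspace_diff)
  ultimately have "u' - u \<in> E \<inter> F" by simp
  then show "u' = u" using assms(3) by simp
qed (use assms in simp)

text \<open>\<open>D\<close> lowers indices: it represents \<open>g v\<close> by a vector through
  the Euclidean inner product. Nondegeneracy makes it bijective, and it carries the
  \<open>g\<close>-complement of \<open>W\<close> onto the Euclidean one, whose dimension is
  known.\<close>

lemma dim_orth_compl:
  fixes g :: "'e::euclidean_space \<Rightarrow> 'e \<Rightarrow> real"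
  assumes g: "bilinear g" "\<And>u v. g u v = g v u" "nondegenerate_on g UNIV" and W: "subspace W"
  shows "dim (orth_compl g W) + dim W = DIM('e)"
proof -
  define D where "D v = (\<Sum>b\<in>Basis. g v b *\<^sub>R b)" for v
  have lin: "linear (\<lambda>u. g v u)" for v using g(1) by (simp add: bilinear_def)
  have D: "u \<bullet> D v = g v u" for u v
  proof -
    have "u \<bullet> D v = (\<Sum>b\<in>Basis. g v ((u \<bullet> b) *\<^sub>R b))"
      by (simp add: D_def inner_sum_right linear_scale[OF lin] mult.commute)
    also have "\<dots> = g v u" by (simp add: linear_sum[OF lin, symmetric] euclidean_representation)
    finally show ?thesis .
  qed
  have linD: "linear D"
    by (rule linearI)
       (simp_all add: D_def bilinear_ladd[OF g(1)] bilinear_lmul[OF g(1)] scaleR_add_left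
         sum.distrib scaleR_sum_right)
  have "v = 0" if "D v = 0" for v
    using g(3) D[of _ v] that unfolding nondegenerate_on_def by simp
  then have inj: "inj D" using linD by (simp add: linear_injective_0)
  then have surj: "surj D" using linD linear_injective_imp_surjective by blast
  have eq: "D ` orth_compl g W = {y. \<forall>u\<in>W. u \<bullet> y = 0}"
  proof (intro equalityI subsetI)
    fix y assume y: "y \<in> {y. \<forall>u\<in>W. u \<bullet> y = 0}"
    obtain v where "y = D v" using surj by (rule surjE)
    then show "y \<in> D ` orth_compl g W" using y g(2) by (auto simp: orth_compl_def D)
  qed (use g(2) in \<open>auto simp: orth_compl_def D\<close>)
  have "dim (D ` orth_compl g W) = dim (orth_compl g W)"
    using linD inj by (meson dim_image_eq inj_on_subset subset_UNIV)
  moreover have "dim {y \<in> UNIV. \<forall>u\<in>W. orthogonal u y} + dim W = dim (UNIV :: 'e set)"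
    by (rule dim_subspace_orthogonal_to_vectors) (use W in auto)
  ultimately show ?thesis by (simp add: eq orthogonal_def)
qed

lemma subspace_orth_compl:
  fixes g :: "'e::euclidean_space \<Rightarrow> 'e \<Rightarrow> real"
  assumes "bilinear g"
  shows "subspace (orth_compl g W)"
  unfolding subspace_def orth_compl_def
  by (auto simp: bilinear_rzero[OF assms] bilinear_radd[OF assms] bilinear_rmul[OF assms])

text \<open>One ambient tangent space: \<open>T\<close>, \<open>R\<close>, \<open>S\<close>,
  \<open>P\<close>, \<open>N\<close> stand for TM, Rad TM, S(TM), S(TM^perp), ltr(TM). The last
  three assumptions say without frames what the dual frames give: \<open>g\<close> pairs
  \<open>N\<close> and \<open>R\<close> perfectly.\<close>

locale lightlike_splitting =
  fixes g :: "'e::euclidean_space \<Rightarrow> 'e \<Rightarrow> real" and T R S P N :: "'e set"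
  assumes bil: "bilinear g" and g_sym: "g u v = g v u" and nondeg: "nondegenerate_on g UNIV"
    and sub_R: "subspace R" and sub_S: "subspace S" and sub_P: "subspace P" and sub_N: "subspace N"
    and T_sum: "orth_direct_sum g T R S" and T_perp_sum: "orth_direct_sum g (orth_compl g T) R P"
    and R_eq: "R = T \<inter> orth_compl g T"
    and N_S: "a \<in> N \<Longrightarrow> s \<in> S \<Longrightarrow> g a s = 0"
    and N_P: "a \<in> N \<Longrightarrow> w \<in> P \<Longrightarrow> g a w = 0"
    and N_onto: "\<exists>a\<in>N. \<forall>\<rho>\<in>R. g a \<rho> = g v \<rho>"
    and N_inj: "a \<in> N \<Longrightarrow> (\<And>\<rho>. \<rho> \<in> R \<Longrightarrow> g a \<rho> = 0) \<Longrightarrow> a = 0"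
    and R_inj: "\<rho> \<in> R \<Longrightarrow> (\<And>a. a \<in> N \<Longrightarrow> g \<rho> a = 0) \<Longrightarrow> \<rho> = 0"
begin

lemmas g_simps = bilinear_ladd[OF bil] bilinear_radd[OF bil] bilinear_lmul[OF bil]
  bilinear_rmul[OF bil] bilinear_lzero[OF bil] bilinear_rzero[OF bil] bilinear_lsub[OF bil]
  bilinear_rsub[OF bil]

lemma T_eq: "T = {u + v |u v. u \<in> R \<and> v \<in> S}"
  using T_sum by (simp add: orth_direct_sum_def)

lemma T_perp_eq: "orth_compl g T = {u + v |u v. u \<in> R \<and> v \<in> P}"
  using T_perp_sum by (simp add: orth_direct_sum_def)

lemma sub_T: "subspace T"
  unfolding T_eq using sub_R sub_S by (rule subspace_sums)

lemma sub_T_perp: "subspace (orth_compl g T)"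
  using bil by (rule subspace_orth_compl)

lemma S_sub_T: "S \<subseteq> T"
  unfolding T_eq using sub_R subspace_0 by force

lemma P_sub_T_perp: "P \<subseteq> orth_compl g T"
  unfolding T_perp_eq using sub_R subspace_0 by force

lemma T_orth_P: "t \<in> T \<Longrightarrow> w \<in> P \<Longrightarrow> g t w = 0"
  using P_sub_T_perp by (auto simp: orth_compl_def)

lemma R_orth_T: "\<rho> \<in> R \<Longrightarrow> t \<in> T \<Longrightarrow> g \<rho> t = 0"
  unfolding R_eq orth_compl_def using g_sym[of \<rho> t] by auto

lemma R_orth_P: "\<rho> \<in> R \<Longrightarrow> w \<in> P \<Longrightarrow> g \<rho> w = 0"
  using T_orth_P R_eq by blast

lemma S_orth_P: "s \<in> S \<Longrightarrow> w \<in> P \<Longrightarrow> g s w = 0"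
  using T_orth_P S_sub_T by blast

lemma R_orth_S: "\<rho> \<in> R \<Longrightarrow> s \<in> S \<Longrightarrow> g \<rho> s = 0"
  using R_orth_T S_sub_T by blast

lemma T_Int_P: "T \<inter> P = {0}"
proof -
  have "T \<inter> P \<subseteq> R \<inter> P" using P_sub_T_perp R_eq by blast
  then show ?thesis
    using T_perp_sum sub_T sub_P subspace_0 unfolding orth_direct_sum_def by blast
qed

text \<open>One inclusion is clear, and the dimensions match: the sum has dimension dim T + dim
  T^perp - dim R = n - dim R.\<close>

lemma R_perp_eq: "orth_compl g R = {u + v |u v. u \<in> T \<and> v \<in> orth_compl g T}"
proof (rule sym)
  let ?E = "{u + v |u v. u \<in> T \<and> v \<in> orth_compl g T}"
  have "dim ?E + dim R = dim T + dim (orth_compl g T)"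
    unfolding R_eq by (rule dim_sums_Int[OF sub_T sub_T_perp])
  moreover have "dim (orth_compl g T) + dim T = DIM('e)"
    by (rule dim_orth_compl[OF bil g_sym nondeg sub_T])
  moreover have "dim (orth_compl g R) + dim R = DIM('e)"
    by (rule dim_orth_compl[OF bil g_sym nondeg sub_R])
  ultimately have "dim (orth_compl g R) \<le> dim ?E" by simp
  moreover have "?E \<subseteq> orth_compl g R"
    using R_orth_T R_eq by (auto simp: orth_compl_def g_simps)
  ultimately show "?E = orth_compl g R"
    by (intro subspace_dim_equal subspace_orth_compl bil subspace_sums sub_T sub_T_perp)
qed

text \<open>Subtracting the \<open>a\<close> in \<open>N\<close> that pairs with \<open>R\<close> as
  \<open>v\<close> does puts the rest into the complement of \<open>R\<close>, hence into T +
  T^perp, where both summands are already split.\<close>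

lemma decomposition:
  obtains \<rho> s a w where "\<rho> \<in> R" "s \<in> S" "a \<in> N" "w \<in> P" "v = \<rho> + s + a + w"
proof -
  obtain a where a: "a \<in> N" "\<forall>\<rho>\<in>R. g a \<rho> = g v \<rho>" using N_onto by blast
  then have "v - a \<in> orth_compl g R" by (simp add: orth_compl_def g_simps g_sym[of _ v] g_sym[of _ a])
  then obtain t p where t: "t \<in> T" "p \<in> orth_compl g T" "v - a = t + p"
    unfolding R_perp_eq by blast
  then obtain \<rho> s \<rho>' w where "\<rho> \<in> R" "s \<in> S" "t = \<rho> + s" "\<rho>' \<in> R" "w \<in> P" "p = \<rho>' + w"
    using T_eq T_perp_eq by blast
  then show thesis
    using that[of "\<rho> + \<rho>'" s a w] a(1) t(3) sub_R by (simp add: subspace_add algebra_simps)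
qed

text \<open>\<open>R\<close> is orthogonal to \<open>T\<close> and \<open>P\<close>, so such a
  vector pairs to 0 with \<open>R\<close>. The directness of the splittings that involve
  \<open>N\<close> rests on this.\<close>

lemma N_zero:
  assumes "a \<in> N" "t \<in> T" "w \<in> P" "a = t + w"
  shows "a = 0"
  using assms(1)
proof (rule N_inj)
  fix \<rho> assume "\<rho> \<in> R"
  then show "g a \<rho> = 0"
    unfolding \<open>a = t + w\<close> using R_orth_T R_orth_P assms by (simp add: g_simps g_sym[of _ \<rho>])
qed

lemma sub_tr: "subspace {u + v |u v. u \<in> N \<and> v \<in> P}"
  using sub_N sub_P by (rule subspace_sums)

lemma T_Int_tr: "T \<inter> {u + v |u v. u \<in> N \<and> v \<in> P} = {0}"
proof -
  have "t = 0" if "t \<in> T" "a \<in> N" "w \<in> P" "t = a + w" for t a w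
  proof -
    have "a = 0"
      using that by (intro N_zero[of a t "- w"]) (auto simp: subspace_neg sub_P)
    then show ?thesis using that T_Int_P by auto
  qed
  then show ?thesis using sub_T sub_tr subspace_0 by blast
qed

lemma P_Int: "P \<inter> {u + v |u v. u \<in> T \<and> v \<in> N} = {0}"
proof -
  have "w = 0" if "t \<in> T" "a \<in> N" "w \<in> P" "w = t + a" for t a w
  proof -
    have "a = 0"
      using that by (intro N_zero[of a "- t" w]) (auto simp: subspace_neg sub_T)
    then show ?thesis using that T_Int_P by auto
  qed
  then show ?thesis using sub_P subspace_sums[OF sub_T sub_N] subspace_0 by blast
qed

lemma component_T:
  assumes "t \<in> T" "a \<in> N" "w \<in> P"
  shows "component T {u + v |u v. u \<in> N \<and> v \<in> P} (t + a + w) = t"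
    and "component {u + v |u v. u \<in> N \<and> v \<in> P} T (t + a + w) = a + w"
    and "component P {u + v |u v. u \<in> T \<and> v \<in> N} (t + a + w) = w"
proof -
  have [simp]: "t + a + w - t = a + w" "t + a + w - (a + w) = t" by simp_all
  show "component T {u + v |u v. u \<in> N \<and> v \<in> P} (t + a + w) = t"
    using assms by (intro component_eqI sub_T sub_tr T_Int_tr) auto
  show "component {u + v |u v. u \<in> N \<and> v \<in> P} T (t + a + w) = a + w"
    using assms T_Int_tr by (intro component_eqI sub_T sub_tr) (auto simp: Int_commute)
  show "component P {u + v |u v. u \<in> T \<and> v \<in> N} (t + a + w) = w"
    using assms by (intro component_eqI sub_P P_Int subspace_sums sub_T sub_N) auto
qed

lemma component_S:
  assumes "\<rho> \<in> R" "s \<in> S"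
  shows "component S R (\<rho> + s) = s" "component R S (\<rho> + s) = \<rho>"
  using assms T_sum unfolding orth_direct_sum_def
  by (auto intro!: component_eqI sub_R sub_S simp: Int_commute)

end

lemma lightlike_splitting_at:
  assumes g: "semi_riemannian_metric (amb L) (metric L) q" and L: "lightlike_submanifold L"
  shows "lightlike_splitting (gM L x) (TM L x) (RadTM L x) (scr L x) (scr_perp L x) (ltr L x)"
proof -
  have bil: "bilinear (gM L x)" and sym: "\<And>u v. gM L x u v = gM L x v u"
    and nd: "nondegenerate_on (gM L x) UNIV"
    using g by (auto simp: semi_riemannian_metric_def gM_def)
  note g_simps = bilinear_ladd[OF bil] bilinear_radd[OF bil] bilinear_lmul[OF bil]
    bilinear_rmul[OF bil] bilinear_lzero[OF bil] bilinear_rzero[OF bil]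
  have lin: "linear (\<lambda>u. gM L x u v)" for v using bil by (simp add: bilinear_def)
  obtain r where R: "smooth_subbundle (amb L) (incl L) r (RadTM L)" and lt: "lightlike_transversal L r"
    using L by (auto simp: lightlike_submanifold_def)
  obtain U \<xi> N where "x \<in> U" and fr: "\<forall>y\<in>U. RadTM L y = span ((\<lambda>i. \<xi> i y) ` {..<r}) \<and>
               ltr L y = span ((\<lambda>i. N i y) ` {..<r}) \<and>
               (\<forall>i<r. N i y \<in> orth_compl (gM L y) (scr_perp L y) \<inter> orth_compl (gM L y) (scr L y)) \<and>
               (\<forall>i<r. \<forall>j<r. gM L y (N i y) (\<xi> j y) = (if i = j then 1 else 0) \<and>
                             gM L y (N i y) (N j y) = 0)"
    using lt[unfolded lightlike_transversal_def, rule_format, of x] by (elim exE conjE)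
  define \<Xi> where "\<Xi> i = \<xi> i x" for i
  define M where "M i = N i x" for i
  have Req: "RadTM L x = span (\<Xi> ` {..<r})" and Neq: "ltr L x = span (M ` {..<r})"
    and orth: "\<And>i w. i < r \<Longrightarrow> w \<in> scr_perp L x \<union> scr L x \<Longrightarrow> gM L x w (M i) = 0"
    and dual: "\<And>i j. i < r \<Longrightarrow> j < r \<Longrightarrow> gM L x (M i) (\<Xi> j) = (if i = j then 1 else 0)"
    using fr \<open>x \<in> U\<close> unfolding M_def \<Xi>_def by (auto simp: orth_compl_def)
  have kernel: "subspace {a. gM L x w a = 0}" for w
    by (rule subspaceI) (simp_all add: g_simps)
  have N_orth: "gM L x w a = 0" if "a \<in> ltr L x" "\<And>i. i < r \<Longrightarrow> gM L x w (M i) = 0" for w a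
    using that span_minimal[OF _ kernel[of w], of "M ` {..<r}"] unfolding Neq by blast
  have R_orth: "gM L x w a = 0" if "a \<in> RadTM L x" "\<And>i. i < r \<Longrightarrow> gM L x w (\<Xi> i) = 0" for w a
    using that span_minimal[OF _ kernel[of w], of "\<Xi> ` {..<r}"] unfolding Req by blast
  \<comment> \<open>Dual basis expansion: both sides are linear in \<open>a\<close> and, by duality
    of the frames, agree on each \<open>M j\<close>. It shows that \<open>R\<close> separates the
    points of \<open>N\<close>; \<open>R_exp\<close> gives the converse.\<close>
  have N_exp: "a = (\<Sum>i<r. gM L x a (\<Xi> i) *\<^sub>R M i)" if "a \<in> ltr L x" for a
  proof -
    have "linear (\<lambda>a. \<Sum>i<r. gM L x a (\<Xi> i) *\<^sub>R M i)"
      by (rule linearI) (simp_all add: g_simps scaleR_add_left sum.distrib scaleR_sum_right)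
    moreover have "y = (\<Sum>i<r. gM L x y (\<Xi> i) *\<^sub>R M i)" if "y \<in> M ` {..<r}" for y
      using that by (auto simp: dual if_distrib[of "\<lambda>c. c *\<^sub>R _"] sum.delta cong: if_cong)
    ultimately show ?thesis
      using linear_eq_on_span[OF linear_id, of _ "M ` {..<r}" a] that Neq by auto
  qed
  have R_exp: "a = (\<Sum>i<r. gM L x a (M i) *\<^sub>R \<Xi> i)" if "a \<in> RadTM L x" for a
  proof -
    have "linear (\<lambda>a. \<Sum>i<r. gM L x a (M i) *\<^sub>R \<Xi> i)"
      by (rule linearI) (simp_all add: g_simps scaleR_add_left sum.distrib scaleR_sum_right)
    moreover have "y = (\<Sum>i<r. gM L x y (M i) *\<^sub>R \<Xi> i)" if "y \<in> \<Xi> ` {..<r}" for y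
      using that by (auto simp: sym[of "\<Xi> _"] dual if_distrib[of "\<lambda>c. c *\<^sub>R _"] sum.delta cong: if_cong)
    ultimately show ?thesis
      using linear_eq_on_span[OF linear_id, of _ "\<Xi> ` {..<r}" a] that Req by auto
  qed
  show ?thesis
  proof
    show "bilinear (gM L x)" "nondegenerate_on (gM L x) UNIV" by (fact bil nd)+
    show "gM L x u v = gM L x v u" for u v by (fact sym)
    show "subspace (RadTM L x)" "subspace (ltr L x)" by (simp_all add: Req Neq)
    show "subspace (scr L x)" "subspace (scr_perp L x)"
      "orth_direct_sum (gM L x) (TM L x) (RadTM L x) (scr L x)"
      "orth_direct_sum (gM L x) (orth_compl (gM L x) (TM L x)) (RadTM L x) (scr_perp L x)"
      using L unfolding lightlike_submanifold_def smooth_subbundle_def TM_perp_def by blast+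
    show "RadTM L x = TM L x \<inter> orth_compl (gM L x) (TM L x)"
      by (simp add: RadTM_def TM_perp_def)
    fix a assume a: "a \<in> ltr L x"
    show "gM L x a s = 0" if "s \<in> scr L x" for s
      using N_orth[OF a, of s] orth that by (simp add: sym[of a])
    show "gM L x a w = 0" if "w \<in> scr_perp L x" for w
      using N_orth[OF a, of w] orth that by (simp add: sym[of a])
    show "a = 0" if zero: "\<And>\<rho>. \<rho> \<in> RadTM L x \<Longrightarrow> gM L x a \<rho> = 0"
    proof -
      have "\<Xi> i \<in> RadTM L x" if "i < r" for i using that by (auto simp: Req intro: span_base)
      then show ?thesis by (subst N_exp[OF a]) (simp add: zero)
    qed
  next
    fix v
    \<comment> \<open>The dual frame supplies the witness: its coefficient at \<open>M i\<close> is
      the pairing of \<open>v\<close> with \<open>\<Xi> i\<close>.\<close>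
    define a where "a = (\<Sum>i<r. gM L x v (\<Xi> i) *\<^sub>R M i)"
    have "gM L x a (\<Xi> j) = gM L x v (\<Xi> j)" if "j < r" for j
    proof -
      have "gM L x a (\<Xi> j) = (\<Sum>i<r. gM L x v (\<Xi> i) * gM L x (M i) (\<Xi> j))"
        by (simp add: a_def linear_sum[OF lin] g_simps)
      also have "\<dots> = (\<Sum>i<r. if i = j then gM L x v (\<Xi> i) else 0)"
        using that by (intro sum.cong) (auto simp: dual)
      finally show ?thesis using that by simp
    qed
    then have "gM L x (a - v) \<rho> = 0" if "\<rho> \<in> RadTM L x" for \<rho>
      by (intro R_orth[OF that]) (simp add: bilinear_lsub[OF bil])
    then have "\<forall>\<rho>\<in>RadTM L x. gM L x a \<rho> = gM L x v \<rho>" by (simp add: bilinear_lsub[OF bil])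
    moreover have "a \<in> ltr L x" unfolding Neq a_def
      by (intro span_sum span_scale span_base) auto
    ultimately show "\<exists>a\<in>ltr L x. \<forall>\<rho>\<in>RadTM L x. gM L x a \<rho> = gM L x v \<rho>" by blast
  next
    fix \<rho> assume \<rho>: "\<rho> \<in> RadTM L x" "\<And>a. a \<in> ltr L x \<Longrightarrow> gM L x \<rho> a = 0"
    have "M i \<in> ltr L x" if "i < r" for i using that by (auto simp: Neq intro: span_base)
    then show "\<rho> = 0" by (subst R_exp[OF \<rho>(1)]) (simp add: \<rho>(2))
  qed
qed

section \<open>Screen generic lightlike submanifolds of locally bronze manifolds\<close>

locale screen_generic_lightlike =
  fixes L :: "('a::{t2_space, second_countable_topology}, 'b::{t2_space, second_countable_topology},
               'e::euclidean_space, 'd::euclidean_space) lightlike_data"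
    and q :: nat
  assumes amb: "smooth_atlas (amb L)" and sub: "smooth_atlas (sub L)"
    and metric: "semi_riemannian_metric (amb L) (metric L) q"
    and bronze: "bronze_structure (amb L) (metric L) (bronze L)"
    and levi: "levi_civita (amb L) (metric L) (levi L)"
    and parallel: "parallel_tensor (amb L) (levi L) (bronze L)"
    and lightlike: "lightlike_submanifold L"
    and generic: "screen_generic L"
begin

sublocale split: lightlike_splitting "gM L x" "TM L x" "RadTM L x" "scr L x" "scr_perp L x" "ltr L x"
  for x
  using metric lightlike by (rule lightlike_splitting_at)

lemma incl: "smooth_map (sub L) (amb L) (incl L)" "inj (incl L)"
  using lightlike by (auto simp: lightlike_submanifold_def submanifold_incl_def)

section \<open>Fibrewise behaviour of J\<close>

lemma linear_JM: "linear (JM L x)"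
  and JM_JM: "JM L x (JM L x v) = 3 *\<^sub>R JM L x v + v"
  and gM_JM: "gM L x (JM L x u) v = gM L x u (JM L x v)"
  using bronze by (simp_all add: bronze_structure_def JM_def gM_def)

text \<open>For v = J s with v and s in the screen, J^2 = 3 J + I gives J v = 3 v + s, again a
  screen vector.\<close>

lemma JM_Bo: "v \<in> Bo L x \<Longrightarrow> JM L x v \<in> Bo L x"
proof -
  assume "v \<in> Bo L x"
  then obtain s where s: "s \<in> scr L x" "v \<in> scr L x" "v = JM L x s" by (auto simp: Bo_def)
  then have "JM L x v = 3 *\<^sub>R v + s" by (simp add: JM_JM)
  then have "JM L x v \<in> scr L x" using s split.sub_S by (simp add: subspace_add subspace_scale)
  then show ?thesis using s(2) by (simp add: Bo_def)
qed

lemma JM_Rad: "v \<in> RadTM L x \<Longrightarrow> JM L x v \<in> RadTM L x"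
  using generic unfolding screen_generic_def by blast

lemma subspace_Bo: "subspace (Bo L x)" and subspace_B': "subspace (B' L x)"
  using generic by (auto simp: screen_generic_def smooth_subbundle_def)

lemma Bo_scr: "v \<in> Bo L x \<Longrightarrow> v \<in> scr L x" and B'_scr: "v \<in> B' L x \<Longrightarrow> v \<in> scr L x"
  by (auto simp: Bo_def B'_def)

lemma Bo_orth_B': "u \<in> Bo L x \<Longrightarrow> z \<in> B' L x \<Longrightarrow> gM L x u z = 0"
  by (auto simp: B'_def orth_compl_def)

lemma Bo_TM: "v \<in> Bo L x \<Longrightarrow> v \<in> TM L x"
  using Bo_scr split.S_sub_T by blast

lemma JM_eq_f_w: "JM L x v = f_part L x v + w_part L x v"
proof -
  obtain \<rho> s a w where d: "\<rho> \<in> RadTM L x" "s \<in> scr L x" "a \<in> ltr L x" "w \<in> scr_perp L x"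
    "JM L x v = \<rho> + s + a + w"
    by (rule split.decomposition)
  then have "\<rho> + s \<in> TM L x" using split.T_eq by blast
  then show ?thesis
    using split.component_T(1,2)[of "\<rho> + s" x a w] d by (simp add: f_part_def w_part_def tr_def)
qed

lemma f_w_parts:
  assumes "Z \<in> \<Gamma> L (B' L)"
  shows "f_part L x (Z x) \<in> B' L x" "w_part L x (Z x) \<in> scr_perp L x"
proof -
  have "(\<lambda>x. f_part L x (Z x)) \<in> \<Gamma> L (B' L)" "(\<lambda>x. w_part L x (Z x)) \<in> \<Gamma> L (scr_perp L)"
    using generic assms unfolding screen_generic_def by blast+
  then show "f_part L x (Z x) \<in> B' L x" "w_part L x (Z x) \<in> scr_perp L x"
    by (auto simp: sections_def)
qed

section \<open>Global sections spanning the fibres, and J on sections\<close>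

lemma B'_sections: "B' L x \<subseteq> span ((\<lambda>Z. Z x) ` \<Gamma> L (B' L))"
proof -
  obtain k where "smooth_subbundle (amb L) (incl L) k (B' L)"
    using generic by (auto simp: screen_generic_def)
  then obtain U s where "open U" "x \<in> U" "\<forall>i<k. smooth_along (amb L) (incl L) (s i)"
    "\<forall>y\<in>U. B' L y = span ((\<lambda>i. s i y) ` {..<k})"
    unfolding smooth_subbundle_def by blast
  then show ?thesis by (rule local_frame_sections[OF amb sub incl _ _ _ _ subspace_B'])
qed

lemma ltr_sections: "ltr L x \<subseteq> span ((\<lambda>N. N x) ` \<Gamma> L (ltr L))"
proof -
  obtain r where r: "lightlike_transversal L r"
    using lightlike by (auto simp: lightlike_submanifold_def)
  obtain U \<xi> N where U: "open U" "x \<in> U"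
    and smooth: "\<forall>i<r. smooth_along (amb L) (incl L) (\<xi> i) \<and> smooth_along (amb L) (incl L) (N i)"
    and frame: "\<forall>y\<in>U. RadTM L y = span ((\<lambda>i. \<xi> i y) ` {..<r}) \<and>
               ltr L y = span ((\<lambda>i. N i y) ` {..<r}) \<and>
               (\<forall>i<r. N i y \<in> orth_compl (gM L y) (scr_perp L y) \<inter> orth_compl (gM L y) (scr L y)) \<and>
               (\<forall>i<r. \<forall>j<r. gM L y (N i y) (\<xi> j y) = (if i = j then 1 else 0) \<and>
                             gM L y (N i y) (N j y) = 0)"
    using r[unfolded lightlike_transversal_def, rule_format, of x] by (elim exE conjE)
  have "\<forall>i<r. smooth_along (amb L) (incl L) (N i)" using smooth by simp
  moreover have "\<forall>y\<in>U. ltr L y = span ((\<lambda>i. N i y) ` {..<r})" using frame by simp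
  ultimately show ?thesis by (rule local_frame_sections[OF amb sub incl U _ _ split.sub_N])
qed

lemma smooth_along_JM:
  assumes "smooth_along (amb L) (incl L) Y"
  shows "smooth_along (amb L) (incl L) (\<lambda>x. JM L x (Y x))"
  unfolding smooth_along_def
proof
  fix x
  obtain Y' U where "smooth_vf (amb L) Y'" "open U" "x \<in> U" "\<And>y. y \<in> U \<Longrightarrow> Y' (incl L y) = Y y"
    using smooth_alongE[OF assms] by metis
  then have "local_extension (amb L) (incl L) x (\<lambda>x. JM L x (Y x)) (\<lambda>p. bronze L p (Y' p))"
    using bronze unfolding local_extension_def bronze_structure_def JM_def by auto
  then show "\<exists>Y'. local_extension (amb L) (incl L) x (\<lambda>x. JM L x (Y x)) Y'" by blast
qed

lemma JM_section: "Y \<in> \<Gamma> L (Bo L) \<Longrightarrow> (\<lambda>x. JM L x (Y x)) \<in> \<Gamma> L (Bo L)"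
  by (simp add: sections_def smooth_along_JM JM_Bo)

text \<open>Since J (J - 3) = I, the preimage is J Y - 3 Y, a section of \<open>Bo\<close> because
  \<open>Bo\<close> is J-invariant.\<close>

lemma Bo_section_is_JM:
  assumes "Y \<in> \<Gamma> L (Bo L)"
  obtains Y' where "Y' \<in> \<Gamma> L (Bo L)" "(\<lambda>x. JM L x (Y' x)) = Y"
proof
  have Y: "smooth_along (amb L) (incl L) Y" "\<And>x. Y x \<in> Bo L x"
    using assms by (auto simp: sections_def)
  have "smooth_along (amb L) (incl L) (\<lambda>x. JM L x (Y x) + (-3) *\<^sub>R Y x)"
    by (intro smooth_along_add[OF amb] smooth_along_scaleR[OF amb] smooth_along_JM Y)
  moreover have "JM L x (Y x) + (-3) *\<^sub>R Y x \<in> Bo L x" for x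
    by (intro subspace_add[OF subspace_Bo] subspace_scale[OF subspace_Bo] JM_Bo Y)
  ultimately show "(\<lambda>x. JM L x (Y x) + (-3) *\<^sub>R Y x) \<in> \<Gamma> L (Bo L)"
    unfolding sections_def by blast
  show "(\<lambda>x. JM L x (JM L x (Y x) + (-3) *\<^sub>R Y x)) = Y"
    by (simp add: linear_add[OF linear_JM] linear_neg[OF linear_JM] linear_diff[OF linear_JM]
        linear_scale[OF linear_JM] JM_JM fun_eq_iff)
qed

section \<open>Pairings of the connection on sections of \<open>Bo\<close>\<close>

lemma Omega_bar_extension:
  assumes "smooth_along (amb L) (incl L) Y"
  obtains Y' U where "smooth_vf (amb L) Y'" "open U" "x \<in> U"
    "\<forall>y\<in>U. Y' (incl L y) = Y y"
    "Omega_bar L X Y x = levi L (incl L x) (X x) Y' + gM L x (Y x) (eta L (incl L x)) *\<^sub>R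
       (coef_l L (incl L x) *\<^sub>R X x + coef_m L (incl L x) *\<^sub>R JM L x (X x))"
proof -
  \<comment> \<open>\<open>connection_along\<close> differentiates an extension picked by choice; it
    is exposed here so that two such extensions can be compared near \<open>x\<close>.\<close>
  define Y' where "Y' = (SOME Y'. local_extension (amb L) (incl L) x Y Y')"
  have "\<exists>Y'. local_extension (amb L) (incl L) x Y Y'"
    using assms by (simp add: smooth_along_def)
  then have "local_extension (amb L) (incl L) x Y Y'"
    unfolding Y'_def by (rule someI_ex)
  then obtain U where U: "smooth_vf (amb L) Y'" "open U" "x \<in> U" "\<forall>y\<in>U. Y' (incl L y) = Y y"
    unfolding local_extension_def by blast
  moreover have "Omega_bar L X Y x = levi L (incl L x) (X x) Y' + gM L x (Y x) (eta L (incl L x)) *\<^sub>R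
       (coef_l L (incl L x) *\<^sub>R X x + coef_m L (incl L x) *\<^sub>R JM L x (X x))"
    using U by (simp add: Omega_bar_def connection_along_def lm_connection_def Y'_def gM_def JM_def)
  ultimately show thesis by (rule that)
qed

lemma Omega_bar_JM:
  assumes X: "X \<in> \<Gamma> L (Bo L)" and Y: "Y \<in> \<Gamma> L (Bo L)" and Z: "Z \<in> \<Gamma> L (B' L)"
  shows "gM L x (Omega_bar L X (\<lambda>y. JM L y (Y y)) x) (JM L x (Z x))
    = 3 * gM L x (Omega_bar L X (\<lambda>y. JM L y (Y y)) x) (Z x) + gM L x (Omega_bar L X Y x) (Z x)"
proof -
  let ?p = "incl L x" and ?v = "X x"
  have v: "?v \<in> Bo L x" "Z x \<in> B' L x" using X Z by (auto simp: sections_def)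
  have sY: "smooth_along (amb L) (incl L) Y" and sZ: "smooth_along (amb L) (incl L) Z"
    using Y Z by (auto simp: sections_def)
  obtain Y1 U1 where Y1: "smooth_vf (amb L) Y1" "open U1" "x \<in> U1"
    "\<forall>y\<in>U1. Y1 (incl L y) = Y y"
    and O1: "Omega_bar L X Y x = levi L ?p (X x) Y1 + gM L x (Y x) (eta L ?p) *\<^sub>R
       (coef_l L ?p *\<^sub>R X x + coef_m L ?p *\<^sub>R JM L x (X x))"
    by (rule Omega_bar_extension[OF sY, where x=x and X=X])
  obtain Y2 U2 where Y2: "smooth_vf (amb L) Y2" "open U2" "x \<in> U2"
    "\<forall>y\<in>U2. Y2 (incl L y) = JM L y (Y y)"
    and O2: "Omega_bar L X (\<lambda>y. JM L y (Y y)) x = levi L ?p (X x) Y2 + gM L x (JM L x (Y x)) (eta L ?p) *\<^sub>R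
       (coef_l L ?p *\<^sub>R X x + coef_m L ?p *\<^sub>R JM L x (X x))"
    by (rule Omega_bar_extension[OF smooth_along_JM[OF sY], where x=x and X=X])
  obtain Z' V where Z': "smooth_vf (amb L) Z'" "x \<in> V" "\<And>y. y \<in> V \<Longrightarrow> Z' (incl L y) = Z y"
    using smooth_alongE[OF sZ] by metis
  have J_vf: "smooth_vf (amb L) (\<lambda>p. bronze L p (W p))" if "smooth_vf (amb L) W" for W
    using bronze that by (simp add: bronze_structure_def)
  have "levi L ?p ?v (\<lambda>p. bronze L p (Y1 p)) = JM L x (levi L ?p ?v Y1)"
    using parallel Y1(1) by (simp add: parallel_tensor_def JM_def)
  \<comment> \<open>\<open>Y2\<close> and J \<open>Y1\<close> may differ off M, but both equal J Y
    along M near \<open>x\<close>; differentiated in a tangential direction they pair alike with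
    every smooth field, and \<nabla> J = 0 takes J out.\<close>
  then have ext: "gM L x (levi L ?p ?v Y2) (W ?p) = gM L x (JM L x (levi L ?p ?v Y1)) (W ?p)"
    if "smooth_vf (amb L) W" for W
    using levi_civita_extension_indep[OF amb sub incl(1) metric levi Y2(1) J_vf[OF Y1(1)],
        of "U1 \<inter> U2" x W ?v] Y1 Y2 that Bo_TM[OF v(1)]
    by (simp add: gM_def JM_def TM_def open_Int)
  have Z_ext: "gM L x (levi L ?p ?v Y2) (Z x) = gM L x (JM L x (levi L ?p ?v Y1)) (Z x)"
    using ext[OF Z'(1)] Z' by simp
  have JZ_ext: "gM L x (levi L ?p ?v Y2) (JM L x (Z x)) = gM L x (JM L x (levi L ?p ?v Y1)) (JM L x (Z x))"
    using ext[OF J_vf[OF Z'(1)]] Z' by (simp add: JM_def)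
  \<comment> \<open>These pairings carry the extra (l,m) terms. Self-adjointness moves J from
    \<open>Z\<close> to the tangent vector, which stays in \<open>Bo\<close>.\<close>
  have zero: "gM L x ?v (Z x) = 0" "gM L x (JM L x ?v) (Z x) = 0"
    "gM L x ?v (JM L x (Z x)) = 0" "gM L x (JM L x ?v) (JM L x (Z x)) = 0"
    using v by (simp_all add: gM_JM[symmetric] Bo_orth_B' JM_Bo)
  have "gM L x (JM L x (levi L ?p ?v Y1)) (JM L x (Z x))
      = 3 * gM L x (JM L x (levi L ?p ?v Y1)) (Z x) + gM L x (levi L ?p ?v Y1) (Z x)"
    by (simp add: gM_JM JM_JM split.g_simps)
  then show ?thesis by (simp add: O1 O2 split.g_simps zero Z_ext JZ_ext)
qed

text \<open>The witness \<open>a\<close> is the lightlike transversal part h^l; it drops out of all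
  pairings below.\<close>

lemma Omega_bar_decomposition:
  obtains a where "a \<in> ltr L x" "h_s L X Y x \<in> scr_perp L x" "Omega_star L X Y x \<in> scr L x"
    "h_star L X Y x \<in> RadTM L x" "Omega L X Y x = h_star L X Y x + Omega_star L X Y x"
    "Omega_bar L X Y x = h_star L X Y x + Omega_star L X Y x + a + h_s L X Y x"
proof -
  obtain \<rho> s a w where d: "\<rho> \<in> RadTM L x" "s \<in> scr L x" "a \<in> ltr L x" "w \<in> scr_perp L x"
    "Omega_bar L X Y x = \<rho> + s + a + w"
    by (rule split.decomposition)
  then have "\<rho> + s \<in> TM L x" using split.T_eq by blast
  then have "Omega L X Y x = \<rho> + s" "h_s L X Y x = w"
    using split.component_T[of "\<rho> + s" x a w] d by (simp_all add: Omega_def h_s_def tr_def)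
  moreover from this have "Omega_star L X Y x = s" "h_star L X Y x = \<rho>"
    using split.component_S[OF d(1,2)] by (simp_all add: Omega_star_def h_star_def)
  ultimately show thesis using that[of a] d by simp
qed

text \<open>Against \<open>Z\<close> in the screen only the \<open>Omega_star\<close> part survives.
  Against J Z = f Z + w Z, with f Z in the screen and w Z in S(TM^perp), the radical and lightlike
  transversal parts vanish, leaving the two terms on the left of (ii).\<close>

lemma Omega_orth_B'_iff:
  assumes X: "X \<in> \<Gamma> L (Bo L)" and Y: "Y \<in> \<Gamma> L (Bo L)" and Z: "Z \<in> \<Gamma> L (B' L)"
  shows "gM L x (Omega L X Y x) (Z x) = 0 \<longleftrightarrow>
    gM L x (Omega_star L X (\<lambda>y. JM L y (Y y)) x) (f_part L x (Z x))
      + gM L x (h_s L X (\<lambda>y. JM L y (Y y)) x) (JM L x (Z x))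
      = 3 * gM L x (Omega_star L X (\<lambda>y. JM L y (Y y)) x) (Z x)"
proof -
  let ?JY = "\<lambda>y. JM L y (Y y)"
  have z: "Z x \<in> scr L x" using Z B'_scr by (auto simp: sections_def)
  have fw: "f_part L x (Z x) \<in> scr L x" "w_part L x (Z x) \<in> scr_perp L x"
    using f_w_parts[OF Z] B'_scr by auto
  obtain a where a: "a \<in> ltr L x" "h_s L X Y x \<in> scr_perp L x"
    "Omega L X Y x = h_star L X Y x + Omega_star L X Y x"
    "Omega_bar L X Y x = h_star L X Y x + Omega_star L X Y x + a + h_s L X Y x"
    by (rule Omega_bar_decomposition)
  then have tr: "gM L x (Omega_bar L X Y x) (Z x) = gM L x (Omega L X Y x) (Z x)"
    using z split.N_S split.S_orth_P by (simp add: split.g_simps split.g_sym[of x "h_s L X Y x"])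
  obtain b where b: "b \<in> ltr L x" "h_s L X ?JY x \<in> scr_perp L x" "Omega_star L X ?JY x \<in> scr L x"
    "h_star L X ?JY x \<in> RadTM L x"
    "Omega_bar L X ?JY x = h_star L X ?JY x + Omega_star L X ?JY x + b + h_s L X ?JY x"
    by (rule Omega_bar_decomposition)
  note orth = split.N_S split.N_P split.S_orth_P split.R_orth_S split.R_orth_P
  have hs: "gM L x (h_s L X ?JY x) s = 0" if "s \<in> scr L x" for s
    using that b(2) split.S_orth_P by (simp add: split.g_sym[of x "h_s L X ?JY x"])
  have "gM L x (Omega_bar L X ?JY x) (Z x) = gM L x (Omega_star L X ?JY x) (Z x)"
    using b z by (simp add: split.g_simps orth hs)
  moreover have "gM L x (Omega_bar L X ?JY x) (JM L x (Z x))
      = gM L x (Omega_star L X ?JY x) (f_part L x (Z x)) + gM L x (h_s L X ?JY x) (JM L x (Z x))"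
    using b fw by (simp add: split.g_simps orth JM_eq_f_w)
  ultimately show ?thesis using Omega_bar_JM[OF assms, of x] tr by auto
qed

text \<open>\<open>J - 3\<close> is the inverse of \<open>J\<close>, so it preserves and is injective on \<open>Rad TM\<close>, on which
  \<open>ltr(TM)\<close> separates points.\<close>
lemma Rad_zero_iff:
  assumes h: "h \<in> RadTM L x"
  shows "(\<forall>N\<in>\<Gamma> L (ltr L). gM L x h (JM L x (N x)) = 3 * gM L x h (N x)) \<longleftrightarrow> h = 0"
proof
  assume N: "\<forall>N\<in>\<Gamma> L (ltr L). gM L x h (JM L x (N x)) = 3 * gM L x h (N x)"
  \<comment> \<open>The assumption says that \<open>?k\<close> is orthogonal to every section of
    ltr(TM).\<close>
  let ?k = "JM L x h - 3 *\<^sub>R h"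
  have k: "?k \<in> RadTM L x"
    using h JM_Rad split.sub_R by (simp add: subspace_diff subspace_scale)
  have "subspace {a. gM L x ?k a = 0}"
    by (rule subspaceI) (simp_all add: split.g_simps algebra_simps)
  moreover have "(\<lambda>N. N x) ` \<Gamma> L (ltr L) \<subseteq> {a. gM L x ?k a = 0}"
    using N by (auto simp: split.g_simps gM_JM)
  ultimately have "ltr L x \<subseteq> {a. gM L x ?k a = 0}"
    using ltr_sections span_minimal by blast
  then have "?k = 0" using split.R_inj[OF k] by blast
  then have "JM L x h = 3 *\<^sub>R h" by simp
  \<comment> \<open>Applying J once more and comparing with J^2 = 3 J + I leaves h = 0.\<close>
  then have "JM L x (JM L x h) = 3 *\<^sub>R JM L x h" by (simp add: linear_scale[OF linear_JM])
  then show "h = 0" by (simp add: JM_JM)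
qed (simp add: split.g_simps)

text \<open>A tangent vector lies in the screen exactly when its radical part vanishes, and a screen
  vector orthogonal to \<open>B'\<close> has zero \<open>B'\<close> component because the metric is
  nondegenerate there.\<close>

lemma Omega_in_Bo_iff:
  "Omega L X Y x \<in> Bo L x \<longleftrightarrow>
    h_star L X Y x = 0 \<and> (\<forall>Z\<in>\<Gamma> L (B' L). gM L x (Omega L X Y x) (Z x) = 0)"
proof -
  obtain s h where sh: "s \<in> scr L x" "h \<in> RadTM L x" "Omega L X Y x = h + s"
    and h: "h_star L X Y x = h"
    by (metis Omega_bar_decomposition[of x X Y])
  have sum: "orth_direct_sum (gM L x) (scr L x) (Bo L x) (B' L x)"
    and nd: "nondegenerate_on (gM L x) (B' L x)"
    using generic by (auto simp: screen_generic_def)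
  show ?thesis
  proof
    assume Bo: "Omega L X Y x \<in> Bo L x"
    then have "h + s - s \<in> scr L x" using sh Bo_scr split.sub_S by (metis subspace_diff)
    then have "h \<in> RadTM L x \<inter> scr L x" using sh by simp
    then have "h = 0" using split.T_sum[of x] unfolding orth_direct_sum_def by blast
    then show "h_star L X Y x = 0 \<and> (\<forall>Z\<in>\<Gamma> L (B' L). gM L x (Omega L X Y x) (Z x) = 0)"
      using h Bo Bo_orth_B' by (auto simp: sections_def)
  next
    assume *: "h_star L X Y x = 0 \<and> (\<forall>Z\<in>\<Gamma> L (B' L). gM L x (Omega L X Y x) (Z x) = 0)"
    then have s: "Omega L X Y x = s" using sh h by simp
    obtain u v where uv: "u \<in> Bo L x" "v \<in> B' L x" "s = u + v"
      using sum sh(1) unfolding orth_direct_sum_def by blast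
    have "subspace {z. gM L x s z = 0}"
      by (rule subspaceI) (simp_all add: split.g_simps)
    moreover have "(\<lambda>Z. Z x) ` \<Gamma> L (B' L) \<subseteq> {z. gM L x s z = 0}"
      using * s by auto
    ultimately have "B' L x \<subseteq> {z. gM L x s z = 0}"
      using B'_sections span_minimal by blast
    then have "gM L x v z = 0" if "z \<in> B' L x" for z
      using that uv Bo_orth_B' by (auto simp: split.g_simps)
    then have "v = 0" using nd uv(2) by (auto simp: nondegenerate_on_def)
    then show "Omega L X Y x \<in> Bo L x" using s uv by simp
  qed
qed

lemma parallel_Bo_iff:
  "parallel_distribution L (Bo L) \<longleftrightarrow>
    (\<forall>X\<in>\<Gamma> L (Bo L). \<forall>Y\<in>\<Gamma> L (Bo L). \<forall>Z\<in>\<Gamma> L (B' L). \<forall>N\<in>\<Gamma> L (ltr L). \<forall>x.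
       gM L x (h_star L X (\<lambda>y. JM L y (Y y)) x) (JM L x (N x))
         = 3 * gM L x (h_star L X (\<lambda>y. JM L y (Y y)) x) (N x) \<and>
       gM L x (Omega_star L X (\<lambda>y. JM L y (Y y)) x) (f_part L x (Z x))
         + gM L x (h_s L X (\<lambda>y. JM L y (Y y)) x) (JM L x (Z x))
         = 3 * gM L x (Omega_star L X (\<lambda>y. JM L y (Y y)) x) (Z x))"
  (is "_ \<longleftrightarrow> (\<forall>X\<in>_. \<forall>Y\<in>_. \<forall>Z\<in>_. \<forall>N\<in>_. \<forall>x. ?i X Y N x \<and> ?ii X Y Z x)")
proof -
  have Rad: "h_star L X Y x \<in> RadTM L x" for X Y x
    by (rule Omega_bar_decomposition)
  \<comment> \<open>The zero sections make both quantifier ranges inhabited, so the joint statement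
    over \<open>Z\<close> and \<open>N\<close> splits into its two conditions.\<close>
  have ne: "(\<lambda>_. 0) \<in> \<Gamma> L (B' L)" "(\<lambda>_. 0) \<in> \<Gamma> L (ltr L)"
    using smooth_vf_zero[OF amb] subspace_B' split.sub_N
    by (auto simp: sections_def smooth_along_def local_extension_def subspace_0)
  have "parallel_distribution L (Bo L) \<longleftrightarrow>
    (\<forall>X\<in>\<Gamma> L (Bo L). \<forall>Y\<in>\<Gamma> L (Bo L). \<forall>x. h_star L X Y x = 0) \<and>
    (\<forall>X\<in>\<Gamma> L (Bo L). \<forall>Y\<in>\<Gamma> L (Bo L). \<forall>Z\<in>\<Gamma> L (B' L). \<forall>x. ?ii X Y Z x)"
    unfolding parallel_distribution_def Omega_in_Bo_iff
    by (auto simp: Omega_orth_B'_iff)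
  \<comment> \<open>J maps the sections of \<open>Bo\<close> onto themselves, so testing on J Y is
    the same as testing on Y.\<close>
  also have "(\<forall>X\<in>\<Gamma> L (Bo L). \<forall>Y\<in>\<Gamma> L (Bo L). \<forall>x. h_star L X Y x = 0) \<longleftrightarrow>
    (\<forall>X\<in>\<Gamma> L (Bo L). \<forall>Y\<in>\<Gamma> L (Bo L). \<forall>x. h_star L X (\<lambda>y. JM L y (Y y)) x = 0)"
  proof (intro iffI ballI allI)
    fix X Y x
    assume *: "\<forall>X\<in>\<Gamma> L (Bo L). \<forall>Y\<in>\<Gamma> L (Bo L). \<forall>x. h_star L X (\<lambda>y. JM L y (Y y)) x = 0"
      and X: "X \<in> \<Gamma> L (Bo L)" and Y: "Y \<in> \<Gamma> L (Bo L)"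
    obtain Y' where "Y' \<in> \<Gamma> L (Bo L)" "(\<lambda>x. JM L x (Y' x)) = Y"
      by (rule Bo_section_is_JM[OF Y])
    then show "h_star L X Y x = 0" using * X by blast
  qed (blast intro: JM_section)
  also have "\<dots> \<longleftrightarrow> (\<forall>X\<in>\<Gamma> L (Bo L). \<forall>Y\<in>\<Gamma> L (Bo L). \<forall>x. \<forall>N\<in>\<Gamma> L (ltr L). ?i X Y N x)"
    by (simp only: Rad_zero_iff[OF Rad])
  finally show ?thesis using ne by blast
qed

end

theorem theorem5p10:
  fixes L :: "('a::{t2_space, second_countable_topology}, 'b::{t2_space, second_countable_topology},
               'e::euclidean_space, 'd::euclidean_space) lightlike_data"
    and q :: nat
  assumes "smooth_atlas (amb L)" and "smooth_atlas (sub L)"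
    and "semi_riemannian_metric (amb L) (metric L) q" and "1 \<le> q" and "q \<le> DIM('e) - 1"
    and "bronze_structure (amb L) (metric L) (bronze L)"
    and "levi_civita (amb L) (metric L) (levi L)"
    and "parallel_tensor (amb L) (levi L) (bronze L)"
    and "lightlike_submanifold L"
    and "screen_generic L"
    and "lm_data L"
  shows "parallel_distribution L (Bo L) \<longleftrightarrow>
    (\<forall>X\<in>\<Gamma> L (Bo L). \<forall>Y\<in>\<Gamma> L (Bo L). \<forall>Z\<in>\<Gamma> L (B' L). \<forall>N\<in>\<Gamma> L (ltr L). \<forall>x.
       gM L x (h_star L X (\<lambda>y. JM L y (Y y)) x) (JM L x (N x))
         = 3 * gM L x (h_star L X (\<lambda>y. JM L y (Y y)) x) (N x) \<and>
       gM L x (Omega_star L X (\<lambda>y. JM L y (Y y)) x) (f_part L x (Z x))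
         + gM L x (h_s L X (\<lambda>y. JM L y (Y y)) x) (JM L x (Z x))
         = 3 * gM L x (Omega_star L X (\<lambda>y. JM L y (Y y)) x) (Z x))"
proof -
  interpret screen_generic_lightlike L q
    using assms by unfold_locales
  show ?thesis by (rule parallel_Bo_iff)
qed

end
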